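(* Let $n>1$ and let $\mathscr{L}=\mathscr{L}(s,\mathbf{u},\mathbf{p})$ be a smooth first-order Lagrangian. If $\mathscr{L}$ is a $\mathcal{T}$-Lagrangian, then $\mathscr{L}$ has the local representation $$\mathscr{L}\big(s,\mathbf{u}(s),\mathbf{u}'(s)\big)=D_s\Psi\big(s,\mathbf{u}(s)\big)+\mathbf{u}'(s)\cdot\mathbf{E}\big(\mathbf{u}(s),\boldsymbol{\theta}(s)\big),$$ where $\boldsymbol{\theta}\in(\mathcal{S}^1)^{n-1}$ is the tuple of spherical angles of $\mathbf{u}'/\|\mathbf{u}'\|$, $\Psi$ is a smooth real-valued function, and $\mathbf{E}=(E_1,\dots,E_n)$ is a smooth $\mathbb{R}^n$-valued function satisfying $\mathbf{E}_{,\boldsymbol{\theta}}^T(\mathbf{u},\boldsymbol{\theta})[\mathbf{u}']=\mathbf{0}$. Explicitly: for every $(s_0,\mathbf{u}_0,\mathbf{p}_0)\in[0,1]\times\mathbb{R}^n\times(\mathbb{R}^n\setminus\{\mathbf{0}\})$ and every $\boldsymbol{\theta}_0$ with $\mathbf{p}_0=r_0\hat{\mathbf{p}}(\boldsymbol{\theta}_0)$, $r_0=\|\mathbf{p}_0\|$, there exist smooth functions $\Psi(s,\mathbf{u})$, defined near $(s_0,\mathbf{u}_0)$, and $\mathbf{E}(\mathbf{u},\boldsymbol{\theta})$, defined near $(\mathbf{u}_0,\boldsymbol{\theta}_0)$, such that for all $(s,\mathbf{u},r,\boldsymbol{\theta})$ near $(s_0,\mathbf{u}_0,r_0,\boldsymbol{\theta}_0)$,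 with $\mathbf{p}=r\hat{\mathbf{p}}(\boldsymbol{\theta})$, $$\mathscr{L}(s,\mathbf{u},\mathbf{p})=\frac{\partial\Psi}{\partial s}(s,\mathbf{u})+\mathbf{p}\cdot\frac{\partial\Psi}{\partial\mathbf{u}}(s,\mathbf{u})+\mathbf{p}\cdot\mathbf{E}(\mathbf{u},\boldsymbol{\theta}),\qquad \sum_{i=1}^n p_i\,\frac{\partial E_i}{\partial\theta_j}(\mathbf{u},\boldsymbol{\theta})=0\quad (j=1,\dots,n-1).$$
   Context: A first-order Lagrangian is a smooth function $\mathscr{L}(s,\mathbf{u},\mathbf{p})$ of $s\in[0,1]$, $\mathbf{u}\in\mathbb{R}^n$, $\mathbf{p}\in\mathbb{R}^n\setminus\{\mathbf{0}\}$; its functional is $\mathcal{E}(\mathbf{u})=\int_0^1\mathscr{L}(s,\mathbf{u}(s),\mathbf{u}'(s))\,ds$. Let $\mathcal{C}^2_R$ be the set of $\mathbf{u}\in C^2([0,1];\mathbb{R}^n)$ with $\mathbf{u}'(s)\neq\mathbf{0}$ for all $s$ (regular curves), and let $\mathcal{C}^\infty_c$ be the smooth functions $[0,1]\to\mathbb{R}^n$ with compact support in $(0,1)$. The first variation is $\delta\mathcal{E}[\delta\mathbf{u}]=\int_0^1(\mathscr{L}_{\mathbf{u}}\cdot\delta\mathbf{u}+\mathscr{L}_{\mathbf{u}'}\cdot\delta\mathbf{u}')\,ds$, where $\mathscr{L}_{\mathbf{u}},\mathscr{L}_{\mathbf{u}'}$ are the gradients of $\mathscr{L}$ in $\mathbf{u}$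 and $\mathbf{p}$ evaluated at $(s,\mathbf{u}(s),\mathbf{u}'(s))$. For $\mathbf{u}\in\mathcal{C}^2_R$ the set of tangential variations is $T_{\mathbf{u}}=\{\mathbf{v}\in\mathcal{C}^\infty_c:\mathbf{v}=\psi\mathbf{u}'\text{ for some }\psi\in C^\infty_c((0,1);\mathbb{R})\}$. $\mathscr{L}$ is a $\mathcal{T}$-Lagrangian if for every $\mathbf{u}\in\mathcal{C}^2_R$, $\delta\mathcal{E}[\delta\mathbf{u}]=0$ for all $\delta\mathbf{u}\in T_{\mathbf{u}}$. $D_s$ is the total derivative with respect to $s$. Spherical angles: for $\boldsymbol{\theta}=(\theta_1,\dots,\theta_{n-1})\in(\mathcal{S}^1)^{n-1}$, $\hat{\mathbf{p}}(\boldsymbol{\theta})\in\mathcal{S}^{n-1}\subset\mathbb{R}^n$ is given by $\hat p_1=\cos\theta_1$, $\hat p_k=\sin\theta_1\cdots\sin\theta_{k-1}\cos\theta_k$ for $2\le k\le n-1$, and $\hat p_n=\sin\theta_1\cdots\sin\theta_{n-1}$. "Near" means in a neighbourhood (relative to $[0,1]$ in the variable $s$). *)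

theory Defs
  imports "HOL-Analysis.Analysis"
begin

text \<open>
  \<open>Ck_on k S f\<close>: \<open>f\<close> is \<open>k\<close> times continuously differentiable on \<open>S\<close>. Derivatives are taken
  within \<open>S\<close>, hence are one-sided in \<open>s\<close> at the ends of the interval \<open>[0,1]\<close>. The notion is only used for
  sets \<open>S\<close> that are open, or relatively open in \<open>[0,1]\<close> or in \<open>[0,1] \<times> \<real>\<^sup>N\<close>; on these the derivative within
  \<open>S\<close> is unique, so that the existential quantifier determines \<open>f'\<close> on \<open>S\<close>.
\<close>

primrec Ck_on :: "nat \<Rightarrow> 'a::real_normed_vector set \<Rightarrow> ('a \<Rightarrow> 'b::real_normed_vector) \<Rightarrow> bool" where
  "Ck_on 0 S f \<longleftrightarrow> continuous_on S f"
| "Ck_on (Suc k) S f \<longleftrightarrow>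
    (\<exists>f'. (\<forall>x\<in>S. (f has_derivative f' x) (at x within S)) \<and> (\<forall>v. Ck_on k S (\<lambda>x. f' x v)))"

definition smooth_on :: "'a::real_normed_vector set \<Rightarrow> ('a \<Rightarrow> 'b::real_normed_vector) \<Rightarrow> bool" where
  "smooth_on S f \<longleftrightarrow> (\<forall>k. Ck_on k S f)"

definition grad :: "('a::real_inner \<Rightarrow> real) \<Rightarrow> 'a \<Rightarrow> 'a" where
  "grad f x = (THE D. GDERIV f x :> D)"

definition smooth_lagrangian :: "(real \<Rightarrow> real^'n \<Rightarrow> real^'n \<Rightarrow> real) \<Rightarrow> bool" where
  "smooth_lagrangian L \<longleftrightarrow>
    smooth_on ({0..1} \<times> UNIV \<times> (UNIV - {0})) (\<lambda>(s, u, p). L s u p)"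

text \<open>
  Functions on \<open>[0,1]\<close> are represented by total functions on the reals of which only the values on
  \<open>[0,1]\<close> matter.
\<close>

definition vderiv01 :: "(real \<Rightarrow> 'a::real_normed_vector) \<Rightarrow> real \<Rightarrow> 'a" where
  "vderiv01 u s = vector_derivative u (at s within {0..1})"

definition C2R :: "(real \<Rightarrow> real^'n) set" where
  "C2R = {u. Ck_on 2 {0..1} u \<and> (\<forall>s\<in>{0..1}. vderiv01 u s \<noteq> 0)}"

text \<open>
  Smooth functions with compact support in \<open>(0,1)\<close>. A member of \<open>C\<^sub>c\<^sup>\<infinity>((0,1))\<close> is identified with its
  extension by zero to \<open>[0,1]\<close>.
\<close>

definition Cc_inf :: "(real \<Rightarrow> 'a::real_normed_vector) set" where
  "Cc_inf = {v. smooth_on {0..1} v \<and> closure {s\<in>{0..1}. v s \<noteq> 0} \<subseteq> {0<..<1}}"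

definition first_variation ::
  "(real \<Rightarrow> real^'n \<Rightarrow> real^'n \<Rightarrow> real) \<Rightarrow> (real \<Rightarrow> real^'n) \<Rightarrow> (real \<Rightarrow> real^'n) \<Rightarrow> real" where
  "first_variation L u \<delta>u =
    integral {0..1} (\<lambda>s.
      grad (\<lambda>w. L s w (vderiv01 u s)) (u s) \<bullet> \<delta>u s
      + grad (\<lambda>q. L s (u s) q) (vderiv01 u s) \<bullet> vderiv01 \<delta>u s)"

definition tangential_variations :: "(real \<Rightarrow> real^'n) \<Rightarrow> (real \<Rightarrow> real^'n) set" where
  "tangential_variations u =
    {v \<in> Cc_inf. \<exists>\<psi>::real \<Rightarrow> real. \<psi> \<in> Cc_inf \<and> (\<forall>s\<in>{0..1}. v s = \<psi> s *\<^sub>R vderiv01 u s)}"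

definition T_lagrangian :: "(real \<Rightarrow> real^'n \<Rightarrow> real^'n \<Rightarrow> real) \<Rightarrow> bool" where
  "T_lagrangian L \<longleftrightarrow>
    (\<forall>u\<in>C2R. \<forall>\<delta>u\<in>tangential_variations u. first_variation L u \<delta>u = 0)"

text \<open>
  The elements of a finite linearly ordered index type are numbered \<open>1, \<dots>, CARD('k)\<close> in increasing
  order.
\<close>

definition pos :: "'k::{finite,linorder} \<Rightarrow> nat" where
  "pos i = card {j. j \<le> i}"

text \<open>
  The unit vector with spherical angles \<open>\<theta>\<close>, for \<open>CARD('n) = CARD('m) + 1\<close>. Angles are
  represented by reals, i.e. in the local coordinates given by the covering \<open>\<real> \<rightarrow> S\<^sup>1\<close>. For the first
  coordinate the product of sines is empty.
\<close>

definition spherical :: "real^'m::{finite,linorder} \<Rightarrow> real^'n::{finite,linorder}" where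
  "spherical \<theta> = (\<chi> i.
    if pos i < CARD('n)
    then (\<Prod>j | pos j < pos i. sin (\<theta> $ j)) * cos (\<theta> $ (THE j. pos j = pos i))
    else (\<Prod>j\<in>UNIV. sin (\<theta> $ j)))"

end

theory Submission
  imports Defs
begin

text \<open>
  Write \<open>K = L - p \<cdot> L\<^sub>p\<close> for the negative of the energy. A tangential variation \<open>\<psi> u'\<close> is an infinitesimal
  reparametrisation, so the vanishing of the first variation is the energy identity \<open>D\<^sub>s K = L\<^sub>s\<close> along
  every regular curve. Along parabolas, where \<open>u''\<close> is arbitrary and small, it forces \<open>K\<^sub>p = 0\<close>.
  Since \<open>n > 1\<close> makes \<open>\<real>\<^sup>n - {0}\<close> connected, \<open>K\<close> is a function \<open>c(s, u)\<close>, and what remains is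
  \<open>L\<^sub>s = c\<^sub>s + p \<cdot> c\<^sub>u\<close>. Hence \<open>M = L - c\<close>, which is positively homogeneous of degree one in \<open>p\<close>, satisfies
  \<open>M\<^sub>s = p \<cdot> c\<^sub>u\<close>. With \<open>\<Psi>(s, u) = \<integral>\<^sub>0\<^sup>s c(\<sigma>, u) d\<sigma>\<close> this integrates to
  \<open>L = \<Psi>\<^sub>s + p \<cdot> \<Psi>\<^sub>u + M(0, u, p)\<close>, and by Euler's relation the last term is \<open>p \<cdot> L\<^sub>p(0, u, p)\<close>, where
  \<open>E = L\<^sub>p(0, u, \<cdot>)\<close> is homogeneous of degree zero with a derivative that annihilates \<open>p\<close>.
\<close>

subsection \<open>Calculus of \<open>C\<^sup>k\<close> functions\<close>

lemma Ck_on_cong: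
  assumes "\<And>x. x \<in> S \<Longrightarrow> f x = g x" "Ck_on k S f"
  shows "Ck_on k S g"
proof (cases k)
  case 0 with assms show ?thesis by (auto cong: continuous_on_cong)
next
  case (Suc l)
  with assms(2) obtain f' where "\<And>x. x \<in> S \<Longrightarrow> (f has_derivative f' x) (at x within S)"
    "\<And>v. Ck_on l S (\<lambda>x. f' x v)" by auto
  moreover from this(1) have "(g has_derivative f' x) (at x within S)" if "x \<in> S" for x
    using has_derivative_transform[OF that _ ] assms(1) that by metis
  ultimately show ?thesis using Suc by auto
qed

lemma Ck_on_SucI:
  assumes "\<And>x. x \<in> S \<Longrightarrow> (f has_derivative f' x) (at x within S)"
    and "\<And>v. Ck_on k S (\<lambda>x. f' x v)"
  shows "Ck_on (Suc k) S f"
  using assms by auto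

lemma Ck_on_SucE:
  assumes "Ck_on (Suc k) S f"
  obtains f' where "\<And>x. x \<in> S \<Longrightarrow> (f has_derivative f' x) (at x within S)"
    and "\<And>v. Ck_on k S (\<lambda>x. f' x v)"
  using assms by auto

lemma Ck_on_SucD: "Ck_on (Suc k) S f \<Longrightarrow> Ck_on k S f"
proof (induction k arbitrary: f)
  case 0
  then show ?case
    by (auto simp: continuous_on_eq_continuous_within intro: has_derivative_continuous)
next
  case (Suc k)
  from Suc.prems obtain f' where "\<And>x. x \<in> S \<Longrightarrow> (f has_derivative f' x) (at x within S)"
    "\<And>v. Ck_on (Suc k) S (\<lambda>x. f' x v)" by (rule Ck_on_SucE) blast
  with Suc.IH show ?case by (intro Ck_on_SucI) auto
qed

lemma Ck_on_const: "Ck_on k S (\<lambda>x. c)"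
proof (induction k arbitrary: c)
  case (Suc k)
  show ?case by (rule Ck_on_SucI[where f' = "\<lambda>x v. 0"]) (auto intro: Suc)
qed simp

lemma Ck_on_linear: "bounded_linear g \<Longrightarrow> Ck_on k S g"
proof (cases k)
  case (Suc l)
  assume "bounded_linear g"
  with Suc show ?thesis
    by (auto intro!: exI[of _ "\<lambda>x. g"] Ck_on_const bounded_linear_imp_has_derivative)
qed (simp add: linear_continuous_on)

lemma Ck_on_add:
  "Ck_on k S f \<Longrightarrow> Ck_on k S g \<Longrightarrow> Ck_on k S (\<lambda>x. f x + g x)"
proof (induction k arbitrary: f g)
  case (Suc k)
  from Suc.prems(1) obtain f' where f': "\<And>x. x \<in> S \<Longrightarrow> (f has_derivative f' x) (at x within S)"
    "\<And>v. Ck_on k S (\<lambda>x. f' x v)" by (rule Ck_on_SucE) blast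
  from Suc.prems(2) obtain g' where g': "\<And>x. x \<in> S \<Longrightarrow> (g has_derivative g' x) (at x within S)"
    "\<And>v. Ck_on k S (\<lambda>x. g' x v)" by (rule Ck_on_SucE) blast
  show ?case
    by (rule Ck_on_SucI[where f' = "\<lambda>x v. f' x v + g' x v"])
      (auto intro!: Suc.IH f' g' has_derivative_add)
qed (auto intro: continuous_intros)

lemma Ck_on_compose_linear:
  assumes "bounded_linear g"
  shows "Ck_on k S f \<Longrightarrow> Ck_on k S (\<lambda>x. g (f x))"
proof (induction k arbitrary: f)
  case 0
  then show ?case
    using bounded_linear.continuous_on[OF assms] by auto
next
  case (Suc k)
  from Suc.prems obtain f' where f': "\<And>x. x \<in> S \<Longrightarrow> (f has_derivative f' x) (at x within S)"
    "\<And>v. Ck_on k S (\<lambda>x. f' x v)" by (rule Ck_on_SucE) blast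
  show ?case
    by (rule Ck_on_SucI[where f' = "\<lambda>x v. g (f' x v)"])
      (auto intro!: Suc.IH f' bounded_linear.has_derivative[OF assms])
qed

lemma Ck_on_bilinear:
  assumes "bounded_bilinear B"
  shows "Ck_on k S f \<Longrightarrow> Ck_on k S g \<Longrightarrow> Ck_on k S (\<lambda>x. B (f x) (g x))"
proof (induction k arbitrary: f g)
  case 0
  then show ?case
    using bounded_bilinear.continuous_on[OF assms] by auto
next
  case (Suc k)
  from Suc.prems(1) obtain f' where f': "\<And>x. x \<in> S \<Longrightarrow> (f has_derivative f' x) (at x within S)"
    "\<And>v. Ck_on k S (\<lambda>x. f' x v)" by (rule Ck_on_SucE) blast
  from Suc.prems(2) obtain g' where g': "\<And>x. x \<in> S \<Longrightarrow> (g has_derivative g' x) (at x within S)"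
    "\<And>v. Ck_on k S (\<lambda>x. g' x v)" by (rule Ck_on_SucE) blast
  show ?case
    by (rule Ck_on_SucI[where f' = "\<lambda>x v. B (f x) (g' x v) + B (f' x v) (g x)"])
      (auto intro!: Suc.IH Ck_on_add f' g' bounded_bilinear.FDERIV[OF assms]
        Suc.prems[THEN Ck_on_SucD])
qed

lemma Ck_on_sum:
  "(\<And>i. i \<in> I \<Longrightarrow> Ck_on k S (f i)) \<Longrightarrow> Ck_on k S (\<lambda>x. \<Sum>i\<in>I. f i x)"
  by (induction I rule: infinite_finite_induct) (auto intro: Ck_on_const Ck_on_add)

lemma Ck_on_prod:
  fixes f :: "'i \<Rightarrow> 'a::real_normed_vector \<Rightarrow> 'b::{real_normed_algebra,comm_ring_1}"
  shows "(\<And>i. i \<in> I \<Longrightarrow> Ck_on k S (f i)) \<Longrightarrow> Ck_on k S (\<lambda>x. \<Prod>i\<in>I. f i x)"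
  by (induction I rule: infinite_finite_induct)
    (auto intro: Ck_on_const Ck_on_bilinear[OF bounded_bilinear_mult])

lemma Ck_on_Pair:
  assumes "Ck_on k S f" "Ck_on k S g"
  shows "Ck_on k S (\<lambda>x. (f x, g x))"
proof -
  have "Ck_on k S (\<lambda>x. (f x, 0))" "Ck_on k S (\<lambda>x. (0, g x))"
    by (auto intro!: Ck_on_compose_linear[OF _ assms(1)] Ck_on_compose_linear[OF _ assms(2)]
        bounded_linear_Pair bounded_linear_ident bounded_linear_zero)
  from Ck_on_add[OF this] show ?thesis by simp
qed

text \<open>\<open>Ck_on\<close> controls a derivative only in fixed directions v. A direction
  \<open>w x\<close> that moves with x is expanded in the basis, which reduces to finitely many
  fixed directions with scalar coefficients of class C^k.\<close>

lemma Ck_on_apply: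
  fixes F :: "'a::real_normed_vector \<Rightarrow> 'b::euclidean_space \<Rightarrow> 'c::real_normed_vector"
  assumes "\<And>x. x \<in> S \<Longrightarrow> bounded_linear (F x)"
    and "\<And>v. v \<in> Basis \<Longrightarrow> Ck_on k S (\<lambda>x. F x v)" "Ck_on k S w"
  shows "Ck_on k S (\<lambda>x. F x (w x))"
proof -
  have coord: "(\<Sum>b\<in>Basis. (w x \<bullet> b) *\<^sub>R F x b) = F x (w x)" if "x \<in> S" for x
  proof -
    interpret bounded_linear "F x" using assms(1) that .
    have "F x (w x) = F x (\<Sum>b\<in>Basis. (w x \<bullet> b) *\<^sub>R b)"
      by (simp only: euclidean_representation)
    then show ?thesis by (simp only: sum scaleR)
  qed
  have "Ck_on k S (\<lambda>x. \<Sum>b\<in>Basis. (w x \<bullet> b) *\<^sub>R F x b)"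
    by (intro Ck_on_sum Ck_on_bilinear[OF bounded_bilinear_scaleR] assms
        Ck_on_compose_linear[OF bounded_linear_inner_left])
  then show ?thesis by (rule Ck_on_cong[rotated]) (rule coord)
qed

text \<open>The chain rule produces \<open>g' (f x) (f' x v)\<close>, whose inner direction depends
  on x; \<open>Ck_on_apply\<close> handles it. The induction varies g alone, because g is replaced
  by its directional derivatives while f stays and merely loses one order.\<close>

lemma Ck_on_compose:
  fixes g :: "'b::euclidean_space \<Rightarrow> 'c::real_normed_vector"
  assumes "f ` S \<subseteq> T"
  shows "Ck_on k T g \<Longrightarrow> Ck_on k S f \<Longrightarrow> Ck_on k S (\<lambda>x. g (f x))"
proof (induction k arbitrary: g)
  case 0
  with assms show ?case by (auto intro: continuous_on_compose2)
next
  case (Suc k)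
  from Suc.prems(1) obtain g' where g': "\<And>x. x \<in> T \<Longrightarrow> (g has_derivative g' x) (at x within T)"
    "\<And>v. Ck_on k T (\<lambda>x. g' x v)" by (rule Ck_on_SucE) blast
  from Suc.prems(2) obtain f' where f': "\<And>x. x \<in> S \<Longrightarrow> (f has_derivative f' x) (at x within S)"
    "\<And>v. Ck_on k S (\<lambda>x. f' x v)" by (rule Ck_on_SucE) blast
  have deriv: "((\<lambda>x. g (f x)) has_derivative (\<lambda>v. g' (f x) (f' x v))) (at x within S)"
    if "x \<in> S" for x
    using that assms by (intro has_derivative_in_compose2[OF g'(1)] f') auto
  have "Ck_on k S (\<lambda>x. g' (f x) (f' x v))" for v
  proof (rule Ck_on_apply[where F = "\<lambda>x. g' (f x)" and w = "\<lambda>x. f' x v"])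
    show "bounded_linear (g' (f x))" if "x \<in> S" for x
      using that assms by (intro has_derivative_bounded_linear[OF g'(1)]) auto
    show "Ck_on k S (\<lambda>x. g' (f x) b)" for b
      by (rule Suc.IH[OF g'(2) Ck_on_SucD[OF Suc.prems(2)]])
  qed (rule f')
  with deriv show ?case by (rule Ck_on_SucI)
qed

lemma Ck_on_subset: "Ck_on k T f \<Longrightarrow> S \<subseteq> T \<Longrightarrow> Ck_on k S f"
proof (induction k arbitrary: f)
  case 0 then show ?case by (auto intro: continuous_on_subset)
next
  case (Suc k)
  from Suc.prems(1) obtain f' where f': "\<And>x. x \<in> T \<Longrightarrow> (f has_derivative f' x) (at x within T)"
    "\<And>v. Ck_on k T (\<lambda>x. f' x v)" by (rule Ck_on_SucE) blast
  with Suc show ?case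
    by (intro Ck_on_SucI[where f' = f']) (auto intro: has_derivative_subset)
qed

text \<open>The shift a closes the induction: differentiating the sine adds pi/2 to its phase, so
  cosine never has to be treated separately.\<close>

lemma Ck_on_sin: "Ck_on k S (\<lambda>x::real. sin (x + a))"
proof (induction k arbitrary: a)
  case (Suc k)
  show ?case
  proof (rule Ck_on_SucI[where f' = "\<lambda>x v. v * sin (x + (a + pi / 2))"])
    show "((\<lambda>x. sin (x + a)) has_derivative (\<lambda>v. v * sin (x + (a + pi / 2)))) (at x within S)" for x
    proof -
      have "((\<lambda>x. sin (x + a)) has_derivative (\<lambda>v. v * cos (x + a))) (at x within S)"
        by (auto intro!: derivative_eq_intros)
      moreover have "sin (x + (a + pi / 2)) = cos (x + a)"
        by (simp add: sin_add cos_add)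
      ultimately show ?thesis by simp
    qed
    show "Ck_on k S (\<lambda>x. v * sin (x + (a + pi / 2)))" for v
      using Ck_on_compose_linear[OF bounded_linear_mult_right Suc.IH] .
  qed
qed (auto intro!: continuous_intros)

lemma Ck_on_cos: "Ck_on k S (cos :: real \<Rightarrow> real)"
  using Ck_on_sin[of k S "pi / 2"] by (simp add: sin_add)


section \<open>Smooth bump functions\<close>

text \<open>The polynomial factor makes the family closed under differentiation.\<close>

definition flat_exp :: "real poly \<Rightarrow> real \<Rightarrow> real" where
  "flat_exp P x = (if x \<le> 0 then 0 else poly P (inverse x) * exp (- inverse x))"

lemma poly_exp_tendsto_0: "((\<lambda>y. poly P y * exp (- y :: real)) \<longlongrightarrow> 0) at_top"
proof -
  have "((\<lambda>y. \<Sum>i\<le>degree P. coeff P i * (y ^ i / exp y)) \<longlongrightarrow> (\<Sum>i\<le>degree P. coeff P i * 0)) at_top"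
    by (intro tendsto_intros tendsto_power_div_exp_0)
  moreover have "(\<Sum>i\<le>degree P. coeff P i * (y ^ i / exp y)) = poly P y * exp (- y)" for y
    unfolding poly_altdef sum_distrib_right
    by (intro sum.cong refl) (simp only: exp_minus divide_inverse mult.assoc)
  ultimately show ?thesis by simp
qed

lemma flat_exp_tendsto_0: "(flat_exp P \<longlongrightarrow> 0) (at 0)"
proof -
  have "((\<lambda>x. poly P (inverse x) * exp (- inverse x)) \<longlongrightarrow> 0) (at_right 0)"
    by (rule filterlim_compose[OF poly_exp_tendsto_0 filterlim_inverse_at_top_right])
  then have "(flat_exp P \<longlongrightarrow> 0) (at_right 0)"
    by (rule Lim_transform_eventually)
      (simp add: flat_exp_def eventually_at_right_field, rule exI[of _ 1], simp)
  moreover have "(flat_exp P \<longlongrightarrow> 0) (at_left 0)"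
    by (rule Lim_transform_eventually[OF tendsto_const])
      (simp add: flat_exp_def eventually_at_left_field, rule exI[of _ "-1"], simp)
  ultimately show ?thesis by (simp add: filterlim_split_at)
qed

text \<open>With y = 1/x, the derivative of P(y) exp(-y) is y^2 (P(y) - P'(y)) exp(-y). The factor
  \<open>[:0, 0, 1:]\<close>, that is y^2, comes from dy/dx = -y^2.\<close>

lemma flat_exp_has_derivative:
  "(flat_exp P has_field_derivative flat_exp ([:0, 0, 1:] * (P - pderiv P)) x) (at x)"
proof -
  consider "x < 0" | "x > 0" | "x = 0" by linarith
  then show ?thesis
  proof cases
    case 1
    have "((\<lambda>x. 0) has_field_derivative 0) (at x)" by simp
    then have "(flat_exp P has_field_derivative 0) (at x)"
      by (rule has_field_derivative_transform_within_open[where S = "{..<0}"])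
        (use 1 in \<open>auto simp: flat_exp_def\<close>)
    with 1 show ?thesis by (simp add: flat_exp_def)
  next
    case 2
    have "((\<lambda>x. poly P (inverse x) * exp (- inverse x)) has_field_derivative
        flat_exp ([:0, 0, 1:] * (P - pderiv P)) x) (at x)"
    proof -
      have inv: "(inverse has_field_derivative - (inverse x)\<^sup>2) (at x)"
        using DERIV_inverse[of x UNIV] 2 by (simp add: power2_eq_square)
      have "((\<lambda>x. poly P (inverse x) * exp (- inverse x)) has_field_derivative
        poly (pderiv P) (inverse x) * - (inverse x)\<^sup>2 * exp (- inverse x)
        + exp (- inverse x) * - (- (inverse x)\<^sup>2) * poly P (inverse x)) (at x)"
        by (intro DERIV_mult DERIV_chain2[OF poly_DERIV inv] DERIV_chain2[OF DERIV_exp] DERIV_minus inv)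
      with 2 show ?thesis
        by (simp add: flat_exp_def algebra_simps power2_eq_square)
    qed
    then show ?thesis
      by (rule has_field_derivative_transform_within_open[where S = "{0<..}"])
        (use 2 in \<open>auto simp: flat_exp_def\<close>)
  next
    case 3
    \<comment> \<open>At 0 the division by h is absorbed as one more polynomial factor y = 1/h, so
      the difference quotient is again a member of the family and tends to 0.\<close>
    have "flat_exp ([:0, 1:] * P) h = (flat_exp P (0 + h) - flat_exp P 0) / h" for h
      by (simp add: flat_exp_def field_simps)
    then have "((\<lambda>h. (flat_exp P (0 + h) - flat_exp P 0) / h) \<longlongrightarrow> 0) (at 0)"
      using flat_exp_tendsto_0[of "[:0, 1:] * P"] by presburger
    with 3 show ?thesis by (simp add: DERIV_def flat_exp_def)
  qed
qed

lemma Ck_on_flat_exp: "Ck_on k S (flat_exp P)"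
proof (induction k arbitrary: P)
  case 0
  show ?case unfolding Ck_on.simps
    by (rule DERIV_continuous_on[OF has_field_derivative_at_within[OF flat_exp_has_derivative]])
next
  case (Suc k)
  show ?case
  proof (rule Ck_on_SucI)
    show "(flat_exp P has_derivative (*) (flat_exp ([:0, 0, 1:] * (P - pderiv P)) x)) (at x within S)" for x
      by (rule has_field_derivative_imp_has_derivative[OF
            has_field_derivative_at_within[OF flat_exp_has_derivative]])
    show "Ck_on k S (\<lambda>x. flat_exp ([:0, 0, 1:] * (P - pderiv P)) x * v)" for v
      by (rule Ck_on_compose_linear[OF bounded_linear_mult_left Suc.IH])
  qed
qed

text \<open>One factor is flat to the left of a, the other to the right of b. With
  \<open>P = 1\<close> both factors are positive on the remaining side, so the product is positive
  exactly on the open interval.\<close>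

definition bump :: "real \<Rightarrow> real \<Rightarrow> real \<Rightarrow> real" where
  "bump a b x = flat_exp 1 (x - a) * flat_exp 1 (b - x)"

lemma bump_nonneg: "bump a b x \<ge> 0"
  by (simp add: bump_def flat_exp_def)

lemma bump_nonzero_iff: "bump a b x \<noteq> 0 \<longleftrightarrow> a < x \<and> x < b"
  by (auto simp: bump_def flat_exp_def)

lemma Ck_on_bump: "Ck_on k S (bump a b)"
proof -
  have "Ck_on k S (\<lambda>x. x - a)" "Ck_on k S (\<lambda>x. b - x)"
    using Ck_on_add[OF Ck_on_linear[OF bounded_linear_ident] Ck_on_const[of k S "- a"]]
      Ck_on_add[OF Ck_on_linear[OF bounded_linear_minus[OF bounded_linear_ident]] Ck_on_const[of k S b]]
    by simp_all
  then show ?thesis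
    unfolding bump_def[abs_def]
    by (intro Ck_on_bilinear[OF bounded_bilinear_mult] Ck_on_compose[OF subset_UNIV Ck_on_flat_exp])
qed

lemma bump_in_Cc_inf:
  assumes "0 < a" "b < 1"
  shows "bump a b \<in> Cc_inf"
proof -
  have "closure {s \<in> {0..1}. bump a b s \<noteq> 0} \<subseteq> {a..b}"
    by (rule closure_minimal) (auto simp: bump_nonzero_iff)
  moreover have "{a..b} \<subseteq> {0<..<1}" using assms by auto
  ultimately show ?thesis by (simp add: Cc_inf_def smooth_on_def Ck_on_bump)
qed

subsection \<open>Derivatives within a set, and the fundamental lemma of the calculus of variations\<close>

text \<open>This is the condition under which a derivative within S is unique: each point can be
  approached along every coordinate axis, from one side at least. It covers the boundary values s =
  0 and s = 1, where S is not open.\<close>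

definition accessible :: "'a::euclidean_space set \<Rightarrow> bool" where
  "accessible S \<longleftrightarrow>
    (\<forall>x\<in>S. \<forall>b\<in>Basis. \<forall>e>0. \<exists>d. 0 < \<bar>d\<bar> \<and> \<bar>d\<bar> < e \<and> x + d *\<^sub>R b \<in> S)"

lemma accessible_interval_times_open:
  fixes T :: "'a::euclidean_space set"
  assumes "open T"
  shows "accessible ({0..1::real} \<times> T)"
  unfolding accessible_def
proof (intro ballI allI impI)
  fix x b :: "real \<times> 'a" and e :: real
  assume x: "x \<in> {0..1::real} \<times> T" and b: "b \<in> Basis" and e: "e > 0"
  obtain s y where xe: "x = (s, y)" "0 \<le> s" "s \<le> 1" "y \<in> T" using x by auto
  consider "b = (1, 0)" | c where "b = (0, c)" "c \<in> Basis"
    using b by (auto simp: Basis_prod_def)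
  then show "\<exists>d. 0 < \<bar>d\<bar> \<and> \<bar>d\<bar> < e \<and> x + d *\<^sub>R b \<in> {0..1} \<times> T"
  proof cases
    case 1
    \<comment> \<open>In the s direction the step points towards the farther end of [0,1]; its
      length is capped by 1/2 so that it stays inside.\<close>
    show ?thesis
    proof (cases "s < 1/2")
      case True
      with 1 xe e show ?thesis by (intro exI[of _ "min (e/2) (1/2)"]) auto
    next
      case False
      with 1 xe e show ?thesis by (intro exI[of _ "- min (e/2) (1/2)"]) auto
    qed
  next
    case 2
    from assms xe(4) obtain r where r: "r > 0" "ball y r \<subseteq> T" by (meson openE)
    define d where "d = min e r / 2"
    have "y + d *\<^sub>R c \<in> ball y r" using r e 2 by (simp add: dist_norm d_def)
    with r e 2 xe show ?thesis by (intro exI[of _ d]) (auto simp: d_def)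
  qed
qed

lemma has_derivative_unique_accessible:
  assumes "accessible S" "x \<in> S"
    and "(f has_derivative f') (at x within S)" "(f has_derivative f'') (at x within S)"
  shows "f' = f''"
  using assms by (intro frechet_derivative_unique_within[OF assms(3,4)]) (auto simp: accessible_def)

text \<open>A canonical derivative, independent of the order k. The definition of
  \<open>Ck_on\<close> only asserts that some f' exists, possibly a different one for each
  k.\<close>

definition deriv_on :: "'a::real_normed_vector set \<Rightarrow> ('a \<Rightarrow> 'b::real_normed_vector) \<Rightarrow> 'a \<Rightarrow> 'a \<Rightarrow> 'b" where
  "deriv_on S f x = frechet_derivative f (at x within S)"

lemma smooth_on_has_derivative:
  assumes "smooth_on S f" "x \<in> S"
  shows "(f has_derivative deriv_on S f x) (at x within S)"
proof -
  have "Ck_on (Suc 0) S f" using assms by (simp add: smooth_on_def del: Ck_on.simps)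
  then have "f differentiable (at x within S)"
    using assms by (auto simp: differentiable_def)
  then show ?thesis by (simp add: deriv_on_def frechet_derivative_works)
qed

text \<open>Each order k supplies its own witness f'; uniqueness on an accessible set identifies all
  of them with \<open>deriv_on\<close> on S.\<close>

lemma smooth_on_deriv_on:
  assumes "smooth_on S f" "accessible S"
  shows "smooth_on S (\<lambda>x. deriv_on S f x v)"
  unfolding smooth_on_def
proof
  fix k
  have "Ck_on (Suc k) S f" using assms by (simp add: smooth_on_def del: Ck_on.simps)
  then obtain f' where f': "\<And>x. x \<in> S \<Longrightarrow> (f has_derivative f' x) (at x within S)"
    "\<And>v. Ck_on k S (\<lambda>x. f' x v)" by (rule Ck_on_SucE) blast
  show "Ck_on k S (\<lambda>x. deriv_on S f x v)"
    by (rule Ck_on_cong[OF fun_cong[OF has_derivative_unique_accessible[OF assms(2) _ f'(1)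
            smooth_on_has_derivative[OF assms(1)]]] f'(2)])
qed

text \<open>Riesz representation: \<open>D\<close> collects the values of g' on the basis, and since
  it is the only vector representing g', the definite description in \<open>grad\<close> returns
  it.\<close>

lemma grad_inner:
  fixes g :: "'a::euclidean_space \<Rightarrow> real"
  assumes "(g has_derivative g') (at x)"
  shows "grad g x \<bullet> v = g' v"
proof -
  interpret bounded_linear g' using assms by (rule has_derivative_bounded_linear)
  define D where "D = (\<Sum>b\<in>Basis. g' b *\<^sub>R b)"
  have inner_D: "h \<bullet> D = g' h" for h
  proof -
    have "g' h = g' (\<Sum>b\<in>Basis. (h \<bullet> b) *\<^sub>R b)" by (simp only: euclidean_representation)
    then show ?thesis by (simp add: D_def inner_sum_right sum scaleR mult.commute)
  qed
  have "GDERIV g x :> D" using assms by (simp add: gderiv_def inner_D)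
  moreover have "D' = D" if "GDERIV g x :> D'" for D'
    using has_derivative_unique[OF assms that[unfolded gderiv_def]] inner_D
    by (metis inner_commute vector_eq_ldot)
  ultimately have "grad g x = D" unfolding grad_def by (rule the_equality)
  then show ?thesis using inner_D[of v] by (simp add: inner_commute)
qed

text \<open>If g were nonzero at an interior s, a bump supported where g keeps its sign would give a
  nonzero integral. The end points follow by continuity.\<close>

lemma fundamental_lemma_calculus_of_variations:
  fixes g :: "real \<Rightarrow> real"
  assumes cont: "continuous_on {0..1} g"
    and int0: "\<And>\<psi>. \<psi> \<in> Cc_inf \<Longrightarrow> integral {0..1} (\<lambda>s. \<psi> s * g s) = 0"
    and "s \<in> {0..1}"
  shows "g s = 0"
proof -
  have inner: "g s = 0" if s: "s \<in> {0<..<1}" for s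
  proof (rule ccontr)
    assume "g s \<noteq> 0"
    \<comment> \<open>Multiplying by the constant \<open>g s\<close> makes the function positive at
      s, whatever the sign of g there.\<close>
    define h where "h x = g x * g s" for x
    have h: "continuous_on {0<..<1} h" unfolding h_def
      by (intro continuous_intros continuous_on_subset[OF cont]) auto
    have "open {x \<in> {0<..<1}. h x \<in> {0<..}}"
      using continuous_open_preimage[OF h open_greaterThanLessThan open_greaterThan]
      by (simp add: vimage_def Int_def)
    moreover have "s \<in> {x \<in> {0<..<1}. h x \<in> {0<..}}"
      using s \<open>g s \<noteq> 0\<close> by (auto simp: h_def zero_less_mult_iff)
    ultimately obtain r where r: "r > 0" "ball s r \<subseteq> {x \<in> {0<..<1}. h x \<in> {0<..}}"
      by (rule openE)
    \<comment> \<open>Half the radius keeps the closed interval, and hence the support of the bump,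
      inside the ball.\<close>
    define a b where "a = s - r / 2" and "b = s + r / 2"
    have "{a..b} \<subseteq> ball s r" using r(1) by (auto simp: a_def b_def dist_real_def)
    with r have ab: "s \<in> {a<..<b}" "{a..b} \<subseteq> {x \<in> {0<..<1}. h x \<in> {0<..}}"
      by (auto simp: a_def b_def)
    have "0 < a" "a < b" "b < 1"
      using ab by (auto simp: subset_iff)
    have "integral {0..1} (\<lambda>x. bump a b x * h x) = integral {0..1} (\<lambda>x. bump a b x * g x) * g s"
      by (simp add: h_def mult.assoc flip: integral_mult_left)
    then have "integral {0..1} (\<lambda>x. bump a b x * h x) = 0" using int0[OF bump_in_Cc_inf] \<open>0 < a\<close> \<open>b < 1\<close> by simp
    moreover have "bump a b x * h x \<ge> 0" if "x \<in> {0..1}" for x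
    proof (cases "bump a b x = 0")
      case False
      then have "x \<in> {a..b}" by (simp add: bump_nonzero_iff)
      with ab(2) have "h x > 0" by auto
      then show ?thesis using bump_nonneg[of a b x] by simp
    qed simp
    moreover have "continuous_on {0..1} (\<lambda>x. bump a b x * h x)" unfolding h_def
      by (intro continuous_intros cont Ck_on_bump[of 0, simplified])
    ultimately have "bump a b s * h s = 0"
      using integral_eq_0_iff[of 0 1 "\<lambda>x. bump a b x * h x"] s by auto
    with ab bump_nonzero_iff[of a b s] \<open>g s \<noteq> 0\<close> show False by (auto simp: h_def)
  qed
  have "closure {0<..<1::real} = {0..1}" by simp
  then show ?thesis
    using continuous_constant_on_closure[of "{0<..<1}" g 0 s] cont inner assms(3) by auto
qed

lemma Ck_on_scaleR_vec: "Ck_on k S a \<Longrightarrow> Ck_on k S (\<lambda>x. a x *\<^sub>R v)"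
  by (rule Ck_on_bilinear[OF bounded_bilinear_scaleR _ Ck_on_const])

lemma vderiv01_eq:
  fixes f :: "real \<Rightarrow> 'a::euclidean_space"
  assumes "s \<in> {0..1}" "(f has_vector_derivative D) (at s within {0..1})"
  shows "vderiv01 f s = D"
  unfolding vderiv01_def
  by (rule vector_derivative_within_closed_interval[OF _ assms]) simp

subsection \<open>The variational identity along parabolas\<close>

text \<open>The quadratic curve with prescribed second-order data at \<open>s\<^sub>1\<close>:
  position u, velocity p and acceleration q. These data can be chosen freely as long as the curve
  stays regular.\<close>

definition parabola :: "real \<Rightarrow> 'a::euclidean_space \<Rightarrow> 'a \<Rightarrow> 'a \<Rightarrow> real \<Rightarrow> 'a" where
  "parabola s\<^sub>1 u p q s = u + (s - s\<^sub>1) *\<^sub>R p + ((s - s\<^sub>1)\<^sup>2 / 2) *\<^sub>R q"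

lemma parabola_has_vector_derivative:
  "(parabola s\<^sub>1 u p q has_vector_derivative p + (s - s\<^sub>1) *\<^sub>R q) (at s within S)"
proof -
  have 1: "((\<lambda>s. s - s\<^sub>1) has_real_derivative 1) (at s within S)"
    by (auto intro!: derivative_eq_intros)
  have 2: "((\<lambda>s. (s - s\<^sub>1)\<^sup>2 / 2) has_real_derivative (s - s\<^sub>1)) (at s within S)"
    by (auto intro!: derivative_eq_intros)
  show ?thesis unfolding parabola_def[abs_def]
    using has_vector_derivative_add[OF has_vector_derivative_add[OF
        has_vector_derivative_const[of u]
        has_vector_derivative_scaleR[OF 1 has_vector_derivative_const[of p]]]
        has_vector_derivative_scaleR[OF 2 has_vector_derivative_const[of q]]] by simp
qed

lemma velocity_has_vector_derivative:
  "((\<lambda>s. p + (s - s\<^sub>1) *\<^sub>R q) has_vector_derivative q) (at s within S)"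
proof -
  have 1: "((\<lambda>s. s - s\<^sub>1) has_real_derivative 1) (at s within S)"
    by (auto intro!: derivative_eq_intros)
  show ?thesis
    using has_vector_derivative_add[OF has_vector_derivative_const[of p]
        has_vector_derivative_scaleR[OF 1 has_vector_derivative_const[of q]]] by simp
qed

lemma Ck_on_velocity: "Ck_on k S (\<lambda>s. p + (s - s\<^sub>1) *\<^sub>R q)"
proof -
  have "Ck_on k S (\<lambda>s. s - s\<^sub>1)"
    using Ck_on_add[OF Ck_on_linear[OF bounded_linear_ident] Ck_on_const[of k S "- s\<^sub>1"]] by simp
  then show ?thesis by (intro Ck_on_add Ck_on_const Ck_on_scaleR_vec)
qed

text \<open>On [0,1] the factor s - \<open>s\<^sub>1\<close> has absolute value at most 1, so the
  correction by q is too short to cancel p. This is where the smallness of q enters.\<close>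

lemma velocity_nonzero:
  fixes p q :: "'a::real_normed_vector"
  assumes "s\<^sub>1 \<in> {0..1}" "s \<in> {0..1}" "norm q < norm p"
  shows "p + (s - s\<^sub>1) *\<^sub>R q \<noteq> 0"
proof
  assume "p + (s - s\<^sub>1) *\<^sub>R q = 0"
  then have "p = - ((s - s\<^sub>1) *\<^sub>R q)" by (simp add: eq_neg_iff_add_eq_0)
  then have "norm p = \<bar>s - s\<^sub>1\<bar> * norm q" by (metis norm_minus_cancel norm_scaleR)
  also have "\<dots> \<le> norm q" using assms by (intro mult_left_le_one_le) auto
  finally show False using assms by simp
qed

lemma vderiv01_parabola: "s \<in> {0..1} \<Longrightarrow> vderiv01 (parabola s\<^sub>1 u p q) s = p + (s - s\<^sub>1) *\<^sub>R q"
  by (rule vderiv01_eq[OF _ parabola_has_vector_derivative])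

lemma parabola_in_C2R:
  assumes "s\<^sub>1 \<in> {0..1}" "norm q < norm p"
  shows "parabola s\<^sub>1 u p q \<in> C2R"
proof -
  have "Ck_on (Suc 1) {0..1} (parabola s\<^sub>1 u p q)"
    by (rule Ck_on_SucI[OF parabola_has_vector_derivative[unfolded has_vector_derivative_def]])
      (intro Ck_on_compose_linear[OF bounded_linear_scaleR_right] Ck_on_velocity)
  then show ?thesis using velocity_nonzero[OF assms(1) _ assms(2)]
    by (simp add: C2R_def vderiv01_parabola numeral_2_eq_2 del: Ck_on.simps)
qed

text \<open>This removes the boundary terms of the integration by parts in
  \<open>energy_identity\<close>.\<close>

lemma Cc_inf_endpoints:
  assumes "\<psi> \<in> Cc_inf"
  shows "\<psi> 0 = 0" "\<psi> 1 = 0"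
proof -
  have "s \<notin> {s \<in> {0..1}. \<psi> s \<noteq> 0}" if "s \<notin> {0<..<1}" for s
    using assms that closure_subset[of "{s \<in> {0..1}. \<psi> s \<noteq> 0}"] by (auto simp: Cc_inf_def)
  from this[of 0] this[of 1] show "\<psi> 0 = 0" "\<psi> 1 = 0" by auto
qed

lemma Cc_inf_has_vector_derivative:
  assumes "\<psi> \<in> Cc_inf" "s \<in> {0..1}"
  shows "(\<psi> has_vector_derivative vderiv01 \<psi> s) (at s within {0..1})"
proof -
  have "(\<psi> has_derivative deriv_on {0..1} \<psi> s) (at s within {0..1})"
    using assms by (intro smooth_on_has_derivative) (auto simp: Cc_inf_def)
  then have "\<psi> differentiable (at s within {0..1})" by (auto simp: differentiable_def)
  then show ?thesis by (simp add: vderiv01_def vector_derivative_works)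
qed

text \<open>The velocity of a parabola is affine in s, so \<psi> u' is smooth and qualifies as a
  tangential variation. For a general curve of class C^2 the product would only be of class
  C^1.\<close>

lemma Cc_inf_scaleR_velocity:
  assumes "\<psi> \<in> Cc_inf"
  shows "(\<lambda>s. \<psi> s *\<^sub>R (p + (s - s\<^sub>1) *\<^sub>R q)) \<in> Cc_inf"
proof -
  have "closure {s \<in> {0..1}. \<psi> s *\<^sub>R (p + (s - s\<^sub>1) *\<^sub>R q) \<noteq> 0} \<subseteq> closure {s \<in> {0..1}. \<psi> s \<noteq> 0}"
    by (rule closure_mono) auto
  moreover have "Ck_on k {0..1} (\<lambda>s. \<psi> s *\<^sub>R (p + (s - s\<^sub>1) *\<^sub>R q))" for k
    using assms
    by (intro Ck_on_bilinear[OF bounded_bilinear_scaleR] Ck_on_velocity) (simp add: Cc_inf_def smooth_on_def)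
  ultimately show ?thesis using assms by (auto simp: Cc_inf_def smooth_on_def)
qed

section \<open>The energy identity for a tangential Lagrangian\<close>

definition phase_space :: "(real \<times> (real^'n) \<times> (real^'n)) set" where
  "phase_space = {0..1} \<times> UNIV \<times> (UNIV - {0})"

lemma accessible_phase_space: "accessible phase_space"
  unfolding phase_space_def
  by (intro accessible_interval_times_open open_Times open_UNIV open_Diff closed_singleton)

lemma accessible_strip: "accessible ({0..1::real} \<times> (UNIV :: 'a::euclidean_space set))"
  by (rule accessible_interval_times_open) simp

locale tangential_lagrangian =
  fixes L :: "real \<Rightarrow> real^'n \<Rightarrow> real^'n \<Rightarrow> real"
  assumes smooth: "smooth_lagrangian L" and tangential: "T_lagrangian L"
begin

abbreviation f :: "real \<times> (real^'n) \<times> (real^'n) \<Rightarrow> real" where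
  "f \<equiv> \<lambda>(s, u, p). L s u p"

abbreviation dL :: "real \<times> (real^'n) \<times> (real^'n) \<Rightarrow> real \<times> (real^'n) \<times> (real^'n) \<Rightarrow> real" where
  "dL \<equiv> deriv_on phase_space f"

text \<open>The value of \<open>dL x\<close> on the vertical direction (0, 0, p) is p . L_p, so K is
  the negative of the energy.\<close>

definition K :: "real \<times> (real^'n) \<times> (real^'n) \<Rightarrow> real" where
  "K x = f x - dL x (0, 0, snd (snd x))"

abbreviation dK :: "real \<times> (real^'n) \<times> (real^'n) \<Rightarrow> real \<times> (real^'n) \<times> (real^'n) \<Rightarrow> real" where
  "dK \<equiv> deriv_on phase_space K"

lemma f_smooth: "smooth_on phase_space f"
  using smooth by (simp add: smooth_lagrangian_def phase_space_def)

lemma dL_smooth: "smooth_on phase_space (\<lambda>x. dL x v)"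
  by (rule smooth_on_deriv_on[OF f_smooth accessible_phase_space])

lemma dL_deriv: "x \<in> phase_space \<Longrightarrow> (f has_derivative dL x) (at x within phase_space)"
  by (rule smooth_on_has_derivative[OF f_smooth])

lemma dL_linear: "x \<in> phase_space \<Longrightarrow> bounded_linear (dL x)"
  by (rule has_derivative_bounded_linear[OF dL_deriv])

lemma K_smooth: "smooth_on phase_space K"
  unfolding smooth_on_def
proof
  fix k
  have "bounded_linear (\<lambda>x::real \<times> (real^'n) \<times> (real^'n). (0::real, 0::real^'n, snd (snd x)))"
    by (intro bounded_linear_intros)
  then have w: "Ck_on k phase_space (\<lambda>x::real \<times> (real^'n) \<times> (real^'n). (0::real, 0::real^'n, snd (snd x)))"
    by (rule Ck_on_linear)
  have "Ck_on k phase_space (\<lambda>x. dL x (0, 0, snd (snd x)))"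
    by (rule Ck_on_apply[OF dL_linear _ w]) (use dL_smooth in \<open>auto simp: smooth_on_def\<close>)
  moreover have "Ck_on k phase_space f" using f_smooth by (simp add: smooth_on_def)
  ultimately have "Ck_on k phase_space (\<lambda>x. f x + - dL x (0, 0, snd (snd x)))"
    by (intro Ck_on_add Ck_on_compose_linear[OF bounded_linear_minus[OF bounded_linear_ident]])
  then show "Ck_on k phase_space K" by (simp add: K_def[abs_def])
qed

lemma dK_smooth: "smooth_on phase_space (\<lambda>x. dK x v)"
  by (rule smooth_on_deriv_on[OF K_smooth accessible_phase_space])

lemma dK_deriv: "x \<in> phase_space \<Longrightarrow> (K has_derivative dK x) (at x within phase_space)"
  by (rule smooth_on_has_derivative[OF K_smooth])

lemma dK_linear: "x \<in> phase_space \<Longrightarrow> bounded_linear (dK x)"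
  by (rule has_derivative_bounded_linear[OF dK_deriv])

text \<open>Restricting the derivative within the phase space to a u-slice gives a two-sided
  derivative, since u ranges over the whole space. This is the form that \<open>grad\<close> in the
  first variation requires; \<open>L_p_deriv\<close> does the same for p on the open punctured
  space.\<close>

lemma L_u_deriv:
  assumes "s \<in> {0..1}" "p \<noteq> 0"
  shows "((\<lambda>w. L s w p) has_derivative (\<lambda>v. dL (s, u, p) (0, v, 0))) (at u)"
proof -
  have "((\<lambda>w. (s, w, p)) has_derivative (\<lambda>v. (0, v, 0))) (at u)"
    by (auto intro!: derivative_eq_intros)
  from has_derivative_in_compose2[OF dL_deriv _ _ this] assms
  show ?thesis by (simp add: phase_space_def image_subset_iff)
qed

lemma L_p_deriv:
  assumes "s \<in> {0..1}" "p \<noteq> 0"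
  shows "((\<lambda>q. L s u q) has_derivative (\<lambda>v. dL (s, u, p) (0, 0, v))) (at p)"
proof -
  have "((\<lambda>q. (s, u, q)) has_derivative (\<lambda>v. (0, 0, v))) (at p within UNIV - {0})"
    by (auto intro!: derivative_eq_intros)
  from has_derivative_in_compose2[OF dL_deriv _ _ this] assms
  have "((\<lambda>q. L s u q) has_derivative (\<lambda>v. dL (s, u, p) (0, 0, v))) (at p within UNIV - {0})"
    by (simp add: phase_space_def image_subset_iff)
  then show ?thesis using assms by (simp add: at_within_open[OF _ open_Diff])
qed

text \<open>With G = p . L_p = L - K, inserting \<psi> u' into the first variation turns its
  integrand into the derivative of \<psi> G plus \<psi> (D_s K - L_s). The first part integrates to
  0 because \<psi> vanishes at both ends, and the fundamental lemma makes D_s K - L_s vanish, in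
  particular at \<open>s\<^sub>1\<close>, where the parabola has the prescribed data.\<close>

lemma energy_identity:
  assumes s\<^sub>1: "s\<^sub>1 \<in> {0..1}" and pq: "norm q < norm p"
  shows "dK (s\<^sub>1, u\<^sub>1, p) (1, p, q) = dL (s\<^sub>1, u\<^sub>1, p) (1, 0, 0)"
proof -
  define u where "u = parabola s\<^sub>1 u\<^sub>1 p q"
  define u' where "u' s = p + (s - s\<^sub>1) *\<^sub>R q" for s
  \<comment> \<open>The lift of the curve to the phase space and its velocity there; total
    derivatives D_s become directional derivatives along \<gamma>'.\<close>
  define \<gamma> where "\<gamma> s = (s, u s, u' s)" for s
  define \<gamma>' where "\<gamma>' s = (1::real, u' s, q)" for s
  have phase: "\<gamma> s \<in> phase_space" if "s \<in> {0..1}" for s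
    using velocity_nonzero[OF s\<^sub>1 that pq] that by (simp add: phase_space_def \<gamma>_def u'_def)
  have u'_deriv: "(u' has_vector_derivative q) (at s within {0..1})" for s
    unfolding u'_def by (rule velocity_has_vector_derivative)
  have \<gamma>_deriv: "(\<gamma> has_vector_derivative \<gamma>' s) (at s within {0..1})" for s
    unfolding \<gamma>_def \<gamma>'_def u_def u'_def
    by (intro has_vector_derivative_Pair has_vector_derivative_id
        parabola_has_vector_derivative velocity_has_vector_derivative)
  have along: "((\<lambda>s. F (\<gamma> s)) has_vector_derivative F' (\<gamma> s) (\<gamma>' s)) (at s within {0..1})"
    if "s \<in> {0..1}" "\<And>x. x \<in> phase_space \<Longrightarrow> (F has_derivative F' x) (at x within phase_space)"
    for s and F :: "_ \<Rightarrow> real" and F'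
  proof -
    have "((\<lambda>s. F (\<gamma> s)) has_derivative (\<lambda>h. F' (\<gamma> s) (h *\<^sub>R \<gamma>' s))) (at s within {0..1})"
      using phase that \<gamma>_deriv[of s]
      by (intro has_derivative_in_compose2[OF that(2)]) (auto simp: has_vector_derivative_def)
    moreover have "F' (\<gamma> s) (h *\<^sub>R \<gamma>' s) = h *\<^sub>R F' (\<gamma> s) (\<gamma>' s)" for h
      using linear_cmul[OF has_derivative_linear[OF that(2)[OF phase[OF that(1)]]]] .
    ultimately show ?thesis by (simp add: has_vector_derivative_def)
  qed
  define g where "g s = dK (\<gamma> s) (\<gamma>' s) - dL (\<gamma> s) (1, 0, 0)" for s
  have g_cont: "continuous_on {0..1} g"
  proof -
    have C0: "Ck_on 0 phase_space (\<lambda>x. dK x v)" "Ck_on 0 phase_space (\<lambda>x. dL x v)" for v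
      using dK_smooth dL_smooth by (simp_all only: smooth_on_def)
    have C0_\<gamma>: "Ck_on 0 {0..1} \<gamma>" "Ck_on 0 {0..1} \<gamma>'"
      using continuous_on_vector_derivative[OF \<gamma>_deriv]
        continuous_on_vector_derivative[OF u'_deriv]
      by (auto simp: \<gamma>'_def intro!: continuous_intros)
    have sub: "\<gamma> ` {0..1} \<subseteq> phase_space" using phase by auto
    have "Ck_on 0 {0..1} (\<lambda>s. dK (\<gamma> s) (\<gamma>' s))"
      by (rule Ck_on_apply[OF dK_linear[OF phase] Ck_on_compose[OF sub C0(1) C0_\<gamma>(1)] C0_\<gamma>(2)])
    moreover have "Ck_on 0 {0..1} (\<lambda>s. dL (\<gamma> s) (1, 0, 0))"
      by (rule Ck_on_compose[OF sub C0(2) C0_\<gamma>(1)])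
    ultimately show ?thesis
      by (auto simp: g_def intro!: continuous_intros)
  qed
  have "g s\<^sub>1 = 0"
  proof (rule fundamental_lemma_calculus_of_variations[OF g_cont _ s\<^sub>1])
    fix \<psi> :: "real \<Rightarrow> real" assume \<psi>: "\<psi> \<in> Cc_inf"
    define \<delta> where "\<delta> s = \<psi> s *\<^sub>R u' s" for s
    define G where "G s = dL (\<gamma> s) (0, 0, u' s)" for s
    have u_deriv: "vderiv01 u s = u' s" if "s \<in> {0..1}" for s
      unfolding u_def u'_def by (rule vderiv01_parabola[OF that])
    have "\<delta> \<in> tangential_variations u"
      using Cc_inf_scaleR_velocity[OF \<psi>] \<psi> u_deriv
      by (auto simp: tangential_variations_def \<delta>_def[abs_def] u'_def)
    moreover have "u \<in> C2R" unfolding u_def by (rule parabola_in_C2R[OF s\<^sub>1 pq])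
    ultimately have "first_variation L u \<delta> = 0" using tangential by (auto simp: T_lagrangian_def)
    moreover have "first_variation L u \<delta> =
        integral {0..1} (\<lambda>s. (vderiv01 \<psi> s * G s + \<psi> s * (dL (\<gamma> s) (\<gamma>' s) - dK (\<gamma> s) (\<gamma>' s))) + \<psi> s * g s)"
      unfolding first_variation_def
    proof (rule Henstock_Kurzweil_Integration.integral_cong)
      fix s :: real assume s: "s \<in> {0..1}"
      interpret dL: bounded_linear "dL (\<gamma> s)" by (rule dL_linear[OF phase[OF s]])
      have nz: "u' s \<noteq> 0" using phase[OF s] by (simp add: phase_space_def \<gamma>_def)
      have "(\<delta> has_vector_derivative \<psi> s *\<^sub>R q + vderiv01 \<psi> s *\<^sub>R u' s) (at s within {0..1})"
        using has_vector_derivative_scaleR[OF _ u'_deriv, of \<psi>] Cc_inf_has_vector_derivative[OF \<psi> s]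
        unfolding \<delta>_def by (simp add: has_real_derivative_iff_has_vector_derivative)
      then have \<delta>': "vderiv01 \<delta> s = \<psi> s *\<^sub>R q + vderiv01 \<psi> s *\<^sub>R u' s" by (rule vderiv01_eq[OF s])
      \<comment> \<open>The variation of (s, u, u') is \<psi>' (0, 0, u') + \<psi> (0, u', q), and
        the last triple is \<gamma>' without its s-component. That missing component is the source
        of the term L_s.\<close>
      have "dL (\<gamma> s) (0, \<delta> s, 0) + dL (\<gamma> s) (0, 0, vderiv01 \<delta> s)
          = dL (\<gamma> s) (vderiv01 \<psi> s *\<^sub>R (0, 0, u' s) + \<psi> s *\<^sub>R (\<gamma>' s - (1, 0, 0)))"
        by (simp add: \<delta>' \<delta>_def \<gamma>'_def algebra_simps flip: dL.add)
      also have "\<dots> = vderiv01 \<psi> s * G s + \<psi> s * (dL (\<gamma> s) (\<gamma>' s) - dL (\<gamma> s) (1, 0, 0))"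
        by (simp only: dL.add dL.scaleR dL.diff G_def real_scaleR_def)
      finally show "grad (\<lambda>w. L s w (vderiv01 u s)) (u s) \<bullet> \<delta> s + grad (L s (u s)) (vderiv01 u s) \<bullet> vderiv01 \<delta> s
          = vderiv01 \<psi> s * G s + \<psi> s * (dL (\<gamma> s) (\<gamma>' s) - dK (\<gamma> s) (\<gamma>' s)) + \<psi> s * g s"
        using grad_inner[OF L_u_deriv[OF s nz]] grad_inner[OF L_p_deriv[OF s nz]]
        by (simp add: u_deriv[OF s] \<gamma>_def g_def algebra_simps)
    qed
    moreover have "((\<lambda>s. vderiv01 \<psi> s * G s + \<psi> s * (dL (\<gamma> s) (\<gamma>' s) - dK (\<gamma> s) (\<gamma>' s)))
        has_integral \<psi> 1 * G 1 - \<psi> 0 * G 0) {0..1}"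
    proof (rule fundamental_theorem_of_calculus)
      fix s :: real assume s: "s \<in> {0..1}"
      have G: "G = (\<lambda>s. f (\<gamma> s) - K (\<gamma> s))"
        by (simp add: K_def G_def[abs_def] \<gamma>_def)
      have "(G has_vector_derivative dL (\<gamma> s) (\<gamma>' s) - dK (\<gamma> s) (\<gamma>' s)) (at s within {0..1})"
        unfolding G by (intro has_vector_derivative_diff along[OF s dL_deriv] along[OF s dK_deriv])
      from has_vector_derivative_mult[OF Cc_inf_has_vector_derivative[OF \<psi> s] this]
      show "((\<lambda>s. \<psi> s * G s) has_vector_derivative
          vderiv01 \<psi> s * G s + \<psi> s * (dL (\<gamma> s) (\<gamma>' s) - dK (\<gamma> s) (\<gamma>' s))) (at s within {0..1})"
        by (simp add: add.commute)
    qed simp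
    moreover have "continuous_on {0..1} \<psi>"
      using Cc_inf_has_vector_derivative[OF \<psi>] by (rule continuous_on_vector_derivative)
    then have "(\<lambda>s. \<psi> s * g s) integrable_on {0..1}"
      by (intro integrable_continuous_real continuous_intros g_cont)
    ultimately show "integral {0..1} (\<lambda>s. \<psi> s * g s) = 0"
      using Cc_inf_endpoints[OF \<psi>]
      by (simp add: Henstock_Kurzweil_Integration.integral_add has_integral_integrable integral_unique)
  qed
  then show ?thesis by (simp add: g_def \<gamma>_def \<gamma>'_def u_def u'_def parabola_def)
qed

section \<open>The energy does not depend on the velocity\<close>

lemma in_phase_space [simp]: "(s, u, p) \<in> phase_space \<longleftrightarrow> s \<in> {0..1} \<and> p \<noteq> 0"
  by (auto simp: phase_space_def)

lemma dK_zero_q: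
  assumes "s \<in> {0..1}" "p \<noteq> 0"
  shows "dK (s, u, p) (1, p, 0) = dL (s, u, p) (1, 0, 0)"
  using energy_identity[of s 0 p u] assms by simp

text \<open>The right-hand side of the energy identity is free of q. Comparing a short acceleration
  t q with acceleration 0 isolates t times the wanted derivative, by linearity.\<close>

lemma dK_momentum:
  assumes "s \<in> {0..1}" "p \<noteq> 0"
  shows "dK (s, u, p) (0, 0, q) = 0"
proof -
  interpret dK: bounded_linear "dK (s, u, p)" using assms by (intro dK_linear) simp
  \<comment> \<open>Chosen so that t q has norm at most half that of p; the summand 1 keeps the
    denominator positive when q = 0.\<close>
  define t where "t = norm p / 2 / (norm q + 1)"
  have pos: "norm p > 0" "norm q + 1 > 0" using assms by (auto simp: add_nonneg_pos)
  then have t: "t > 0" by (simp add: t_def)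
  have "norm (t *\<^sub>R q) < norm p"
  proof -
    have "norm (t *\<^sub>R q) \<le> t * (norm q + 1)" using t by simp
    also have "\<dots> = norm p / 2"
      unfolding t_def using pos(2) by (intro nonzero_eq_divide_eq[THEN iffD1, OF _ refl]) simp
    finally show ?thesis using pos(1) by linarith
  qed
  then have "dK (s, u, p) (1, p, t *\<^sub>R q) = dK (s, u, p) (1, p, 0)"
    using energy_identity dK_zero_q assms by simp
  moreover have "(1, p, t *\<^sub>R q) = (1, p, 0) + t *\<^sub>R (0, 0, q)" by simp
  ultimately have "t * dK (s, u, p) (0, 0, q) = 0"
    by (metis add_cancel_left_right dK.add dK.scaleR real_scaleR_def)
  then show ?thesis using t by simp
qed

lemma K_p_deriv:
  assumes "s \<in> {0..1}" "p \<noteq> 0"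
  shows "((\<lambda>q. K (s, u, q)) has_derivative (\<lambda>v. 0)) (at p)"
proof -
  have "((\<lambda>q. (s, u, q)) has_derivative (\<lambda>v. (0, 0, v))) (at p within UNIV - {0})"
    by (auto intro!: derivative_eq_intros)
  from has_derivative_in_compose2[OF dK_deriv _ _ this] assms
  have "((\<lambda>q. K (s, u, q)) has_derivative (\<lambda>v. dK (s, u, p) (0, 0, v))) (at p within UNIV - {0})"
    by (simp add: image_subset_iff)
  then show ?thesis using assms by (simp add: at_within_open[OF _ open_Diff] dK_momentum)
qed

text \<open>A vanishing derivative gives constancy on connected sets, and the punctured space is
  connected in dimension at least 2.\<close>

lemma K_independent:
  assumes "CARD('n) > 1" "s \<in> {0..1}" "p \<noteq> 0" "q \<noteq> 0"
  shows "K (s, u, p) = K (s, u, q)"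
proof -
  have "connected (- {0 :: real^'n})"
    using assms(1) by (intro connected_punctured_universe) simp
  then show ?thesis
    using has_derivative_zero_unique_connected[of "- {0}" "\<lambda>q. K (s, u, q)" p q] K_p_deriv assms
    by (simp add: open_Compl)
qed

section \<open>Homogeneity of the momentum\<close>

text \<open>Differentiating \<open>p \<cdot> L\<^sub>p - L = const\<close> in \<open>p\<close> shows that the Hessian of \<open>L\<close> in \<open>p\<close>
  annihilates \<open>p\<close>.\<close>

lemma hessian_annihilates:
  assumes "s \<in> {0..1}" "p \<noteq> 0"
  shows "((\<lambda>q. dL (s, u, q) (0, 0, p)) has_derivative (\<lambda>v. 0)) (at p)"
proof -
  have sub: "(\<lambda>q. (s, u, q)) ` (UNIV - {0}) \<subseteq> phase_space" using assms by auto
  have emb: "((\<lambda>q. (s, u, q)) has_derivative (\<lambda>v. (0, 0, v))) (at p within UNIV - {0})"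
    by (auto intro!: derivative_eq_intros)
  have diffble: "(\<lambda>q. dL (s, u, q) w) differentiable (at p)" for w
  proof -
    have "\<And>x. x \<in> phase_space \<Longrightarrow>
        ((\<lambda>x. dL x w) has_derivative deriv_on phase_space (\<lambda>x. dL x w) x) (at x within phase_space)"
      by (rule smooth_on_has_derivative[OF dL_smooth])
    from has_derivative_in_compose2[OF this sub _ emb] assms
    show ?thesis by (auto simp: at_within_open[OF _ open_Diff] differentiable_def)
  qed
  obtain G where G: "((\<lambda>q. dL (s, u, q) (0, 0, p)) has_derivative G) (at p)" using diffble unfolding differentiable_def by blast
  \<comment> \<open>The direction q - p vanishes at q = p. After expansion in coordinates, the
    product rule therefore loses every term that differentiates dL, leaving L_p at p.\<close>
  have "((\<lambda>q. dL (s, u, q) (0, 0, q - p)) has_derivative (\<lambda>v. dL (s, u, p) (0, 0, v))) (at p)"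
  proof -
    define H where "H i = frechet_derivative (\<lambda>q. dL (s, u, q) (0, 0, axis i 1)) (at p)" for i
    have H: "((\<lambda>q. dL (s, u, q) (0, 0, axis i 1)) has_derivative H i) (at p)" for i
      unfolding H_def using diffble by (simp add: frechet_derivative_works)
    have coord: "((\<lambda>q. (q - p) $ i) has_derivative (\<lambda>v. v $ i)) (at p)" for i
      by (rule bounded_linear.has_derivative[OF bounded_linear_vec_nth])
        (auto intro!: derivative_eq_intros)
    have "((\<lambda>q. \<Sum>i\<in>UNIV. (q - p) $ i * dL (s, u, q) (0, 0, axis i 1)) has_derivative
       (\<lambda>v. \<Sum>i\<in>UNIV. (p - p) $ i * H i v + v $ i * dL (s, u, p) (0, 0, axis i 1))) (at p)"
      by (intro has_derivative_sum has_derivative_mult H coord)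
    moreover have comp: "(\<Sum>i\<in>UNIV. x $ i * dL (s, u, q) (0, 0, axis i 1)) = dL (s, u, q) (0, 0, x)"
      if "q \<noteq> 0" for x q
    proof -
      interpret B: bounded_linear "\<lambda>v. dL (s, u, q) (0, 0, v)"
        using L_p_deriv[OF assms(1) that] by (rule has_derivative_bounded_linear)
      have "dL (s, u, q) (0, 0, x) = dL (s, u, q) (0, 0, \<Sum>i\<in>UNIV. (x $ i) *\<^sub>R axis i 1)"
        by (simp only: basis_expansion flip: scalar_mult_eq_scaleR)
      then show ?thesis by (simp only: B.sum B.scaleR real_scaleR_def)
    qed
    ultimately have "((\<lambda>q. \<Sum>i\<in>UNIV. (q - p) $ i * dL (s, u, q) (0, 0, axis i 1)) has_derivative
       (\<lambda>v. dL (s, u, p) (0, 0, v))) (at p)"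
      using assms(2) by simp
    then show ?thesis
      by (rule has_derivative_transform_within_open[where s = "UNIV - {0}"])
        (use assms(2) comp in \<open>auto simp: open_Diff simp del: vector_minus_component\<close>)
  qed
  \<comment> \<open>Splitting q = p + (q - p) writes K as L minus two momentum terms. The derivative
    of L cancels that of the second, so K has derivative -G at p; since K is constant in p to first
    order, G = 0.\<close>
  from has_derivative_diff[OF has_derivative_diff[OF L_p_deriv[OF assms, of u] G] this]
  have "((\<lambda>q. L s u q - dL (s, u, q) (0, 0, p) - dL (s, u, q) (0, 0, q - p)) has_derivative (\<lambda>v. - G v)) (at p)"
    by simp
  then have "((\<lambda>q. K (s, u, q)) has_derivative (\<lambda>v. - G v)) (at p)"
  proof (rule has_derivative_transform_within_open)
    fix q :: "real^'n" assume q: "q \<in> UNIV - {0}"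
    interpret dLq: bounded_linear "dL (s, u, q)" using assms q by (intro dL_linear) simp
    have "dL (s, u, q) (0, 0, p) + dL (s, u, q) (0, 0, q - p) = dL (s, u, q) (0, 0, q)"
      by (simp flip: dLq.add)
    then show "L s u q - dL (s, u, q) (0, 0, p) - dL (s, u, q) (0, 0, q - p) = K (s, u, q)"
      by (simp add: K_def)
  qed (use assms in \<open>auto simp: open_Diff\<close>)
  from has_derivative_unique[OF this K_p_deriv[OF assms]] have "G = (\<lambda>v. 0)"
    by (simp add: fun_eq_iff)
  then show ?thesis using G by simp
qed

text \<open>Along the ray through q the derivative of the momentum component in direction q is q .
  L_pp q, taken at t q, and the Hessian annihilates the radial direction.\<close>

lemma momentum_homogeneous:
  assumes "s \<in> {0..1}" "q \<noteq> 0" "r > 0"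
  shows "dL (s, u, r *\<^sub>R q) (0, 0, q) = dL (s, u, q) (0, 0, q)"
proof -
  define h where "h t = dL (s, u, t *\<^sub>R q) (0, 0, q)" for t
  have h: "(h has_derivative (\<lambda>v. 0)) (at t)" if "t > 0" for t
  proof -
    have tq: "t *\<^sub>R q \<noteq> 0" using that assms by simp
    have "((\<lambda>p. dL (s, u, p) (0, 0, t *\<^sub>R q)) has_derivative (\<lambda>v. 0)) (at (t *\<^sub>R q))"
      by (rule hessian_annihilates[OF assms(1) tq])
    then have "((\<lambda>\<tau>. dL (s, u, \<tau> *\<^sub>R q) (0, 0, t *\<^sub>R q)) has_derivative (\<lambda>v. 0)) (at t)"
      by (rule has_derivative_compose[rotated]) (auto intro!: derivative_eq_intros)
    then have "((\<lambda>\<tau>. inverse t * dL (s, u, \<tau> *\<^sub>R q) (0, 0, t *\<^sub>R q)) has_derivative (\<lambda>v. inverse t * 0)) (at t)"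
      by (rule has_derivative_mult_right)
    moreover have "inverse t * dL (s, u, \<tau> *\<^sub>R q) (0, 0, t *\<^sub>R q) = h \<tau>" if "\<tau> > 0" for \<tau>
    proof -
      interpret dLq: bounded_linear "dL (s, u, \<tau> *\<^sub>R q)" using assms that by (intro dL_linear) simp
      show ?thesis using dLq.scaleR[of t "(0, 0, q)"] \<open>t > 0\<close> by (simp add: h_def)
    qed
    ultimately show ?thesis
      using has_derivative_transform_within_open[where s = "{0<..}" and g = h and x = t] that by simp
  qed
  have "h r = h 1"
    using has_derivative_zero_unique_connected[of "{0<..}" h r 1] h assms(3) by simp
  then show ?thesis by (simp add: h_def)
qed

subsection \<open>The potential and the homogeneous part\<close>

text \<open>\<open>1\<close> is the vector with all entries one, an arbitrary nonzero velocity. For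
  n > 1 the choice is immaterial by \<open>K_independent\<close>.\<close>

definition c :: "real \<times> (real^'n) \<Rightarrow> real" where
  "c = (\<lambda>(s, u). K (s, u, 1))"

abbreviation dc :: "real \<times> (real^'n) \<Rightarrow> real \<times> (real^'n) \<Rightarrow> real" where
  "dc \<equiv> deriv_on ({0..1} \<times> UNIV) c"

definition M :: "real \<Rightarrow> real^'n \<Rightarrow> real^'n \<Rightarrow> real" where
  "M s u p = L s u p - c (s, u)"

lemma Ck_on_strip_slice:
  fixes g :: "real \<times> (real^'n) \<times> (real^'n) \<Rightarrow> real"
  assumes "Ck_on k phase_space g" "p \<noteq> 0"
  shows "Ck_on k ({0..1} \<times> UNIV) (\<lambda>(s, u). g (s, u, p))"
proof -
  have "Ck_on k ({0..1} \<times> UNIV) (\<lambda>x::real \<times> (real^'n). (fst x, snd x, p))"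
    by (intro Ck_on_Pair Ck_on_const Ck_on_linear bounded_linear_fst bounded_linear_snd)
  from Ck_on_compose[OF _ assms(1) this] assms(2) show ?thesis
    by (simp add: phase_space_def image_subset_iff case_prod_unfold)
qed

lemma c_smooth: "smooth_on ({0..1} \<times> UNIV) c"
  unfolding smooth_on_def c_def
  using K_smooth by (auto intro: Ck_on_strip_slice simp: smooth_on_def)

lemma dc_smooth: "smooth_on ({0..1} \<times> UNIV) (\<lambda>x. dc x v)"
  by (rule smooth_on_deriv_on[OF c_smooth accessible_strip])

lemma c_deriv:
  "x \<in> {0..1} \<times> UNIV \<Longrightarrow> (c has_derivative dc x) (at x within {0..1} \<times> UNIV)"
  by (rule smooth_on_has_derivative[OF c_smooth])

lemma dc_linear: "s \<in> {0..1} \<Longrightarrow> bounded_linear (dc (s, u))"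
  by (rule has_derivative_bounded_linear[OF c_deriv]) simp

lemma M_smooth:
  assumes "p \<noteq> 0"
  shows "smooth_on ({0..1} \<times> UNIV) (\<lambda>(s, u). M s u p)"
  unfolding smooth_on_def
proof
  fix k
  have "Ck_on k ({0..1} \<times> UNIV) (\<lambda>(s, u). L s u p)"
    using Ck_on_strip_slice[OF _ assms, of k f] f_smooth by (simp add: smooth_on_def)
  moreover have "Ck_on k ({0..1} \<times> UNIV) (\<lambda>x. - c x)"
    using c_smooth
    by (intro Ck_on_compose_linear[OF bounded_linear_minus[OF bounded_linear_ident]]) (simp add: smooth_on_def)
  ultimately show "Ck_on k ({0..1} \<times> UNIV) (\<lambda>(s, u). M s u p)"
    using Ck_on_add by (fastforce simp: M_def case_prod_unfold)
qed

text \<open>Since c also equals K with velocity slot p, its derivative in direction (1, p) is that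
  of K in direction (1, p, 0), to which the energy identity with q = 0 applies.\<close>

lemma dc_diagonal:
  assumes "CARD('n) > 1" "s \<in> {0..1}" "p \<noteq> 0"
  shows "dc (s, u) (1, p) = dL (s, u, p) (1, 0, 0)"
proof -
  have "((\<lambda>x. (fst x, snd x, p)) has_derivative (\<lambda>v. (fst v, snd v, 0))) (at (s, u) within {0..1} \<times> UNIV)"
    by (auto intro!: derivative_eq_intros)
  from has_derivative_in_compose2[OF dK_deriv _ _ this] assms(2,3)
  have "((\<lambda>x. K (fst x, snd x, p)) has_derivative (\<lambda>v. dK (s, u, p) (fst v, snd v, 0)))
      (at (s, u) within {0..1} \<times> UNIV)"
    by (simp add: image_subset_iff)
  then have "(c has_derivative (\<lambda>v. dK (s, u, p) (fst v, snd v, 0))) (at (s, u) within {0..1} \<times> UNIV)"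
    by (rule has_derivative_transform[rotated 2])
      (use K_independent[OF assms(1) _ _ assms(3), of _ 1] assms(2) in \<open>auto simp: c_def\<close>)
  then have "dc (s, u) = (\<lambda>v. dK (s, u, p) (fst v, snd v, 0))"
    using has_derivative_unique_accessible[OF accessible_strip _ c_deriv] assms(2) by simp
  then show ?thesis using dK_zero_q[OF assms(2,3)] by simp
qed

text \<open>M_s = L_s - c_s, and \<open>dc_diagonal\<close> rewrites L_s as c_s + p . c_u.\<close>

lemma M_s_deriv:
  assumes "CARD('n) > 1" "s \<in> {0..1}" "p \<noteq> 0"
  shows "((\<lambda>s. M s u p) has_vector_derivative dc (s, u) (0, p)) (at s within {0..1})"
proof -
  have "((\<lambda>s. (s, u, p)) has_derivative (\<lambda>v. (v, 0, 0))) (at s within {0..1})"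
    by (auto intro!: derivative_eq_intros simp: zero_prod_def)
  from has_derivative_in_compose2[OF dL_deriv _ _ this] assms(2,3)
  have "((\<lambda>s. L s u p) has_derivative (\<lambda>v. dL (s, u, p) (v, 0, 0))) (at s within {0..1})"
    by (simp add: image_subset_iff)
  moreover have "((\<lambda>s. (s, u)) has_derivative (\<lambda>v. (v, 0))) (at s within {0..1})"
    by (auto intro!: derivative_eq_intros)
  from has_derivative_in_compose2[OF c_deriv _ _ this] assms(2)
  have "((\<lambda>s. c (s, u)) has_derivative (\<lambda>v. dc (s, u) (v, 0))) (at s within {0..1})"
    by (simp add: image_subset_iff mem_Times_iff)
  ultimately have "((\<lambda>s. M s u p) has_derivative (\<lambda>v. dL (s, u, p) (v, 0, 0) - dc (s, u) (v, 0))) (at s within {0..1})"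
    unfolding M_def by (rule has_derivative_diff)
  moreover have "dL (s, u, p) (v, 0, 0) - dc (s, u) (v, 0) = v *\<^sub>R dc (s, u) (0, p)" for v
  proof -
    interpret dL: bounded_linear "dL (s, u, p)" using assms by (intro dL_linear) simp
    interpret dc: bounded_linear "dc (s, u)" using assms by (intro dc_linear)
    have "dL (s, u, p) (v, 0, 0) = v * dL (s, u, p) (1, 0, 0)" using dL.scaleR[of v "(1, 0, 0)"] by simp
    moreover have "dc (s, u) (v, 0) = v * dc (s, u) (1, 0)" using dc.scaleR[of v "(1, 0)"] by simp
    moreover have "dc (s, u) (1, p) = dc (s, u) (1, 0) + dc (s, u) (0, p)" by (simp flip: dc.add)
    ultimately show ?thesis using dc_diagonal[OF assms, of u] by (simp add: algebra_simps)
  qed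
  ultimately show ?thesis by (simp add: has_vector_derivative_def)
qed

text \<open>Starting the integral at 0 gives \<Psi>(0, u) = 0; the remainder of L is then the value
  of M at s = 0, which is free of s.\<close>

definition \<Psi> :: "real \<Rightarrow> real^'n \<Rightarrow> real" where
  "\<Psi> s u = integral {0..s} (\<lambda>\<sigma>. c (\<sigma>, u))"

text \<open>The increment of \<open>M\<close> is linear in \<open>p\<close>; the case distinction fills in the value at \<open>p = 0\<close>, where
  \<open>M\<close> is not controlled.\<close>

definition \<Psi>\<^sub>u :: "real \<Rightarrow> real^'n \<Rightarrow> real^'n \<Rightarrow> real" where
  "\<Psi>\<^sub>u s u p = (if p = 0 then 0 else M s u p - M 0 u p)"

lemma c_continuous: "continuous_on {0..1} (\<lambda>\<sigma>. c (\<sigma>, u))"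
proof -
  have "Ck_on 0 ({0..1} \<times> UNIV) c" using c_smooth by (simp only: smooth_on_def)
  then have "continuous_on ({0..1} \<times> UNIV) c" by simp
  then show ?thesis by (rule continuous_on_compose2) (auto intro!: continuous_intros)
qed

lemma \<Psi>_s_deriv:
  "s \<in> {0..1} \<Longrightarrow> ((\<lambda>s. \<Psi> s u) has_vector_derivative c (s, u)) (at s within {0..1})"
  unfolding \<Psi>_def by (rule integral_has_vector_derivative[OF c_continuous])

text \<open>Differentiation under the integral gives the integral of v . c_u, which is the integral
  of M_s, that is, the increment of M. This closed form later yields the smoothness of the
  potential.\<close>

lemma \<Psi>_u_deriv:
  assumes "CARD('n) > 1" "s \<in> {0..1}"
  shows "(\<Psi> s has_derivative \<Psi>\<^sub>u s u) (at u)"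
proof -
  \<comment> \<open>The Leibniz rule asks for a derivative that is continuous as an operator; in
    finite dimension its continuity is checked on each fixed direction.\<close>
  define D where "D w \<sigma> = Blinfun (\<lambda>v. dc (\<sigma>, w) (0, v))" for w \<sigma>
  have c_u: "((\<lambda>w. c (\<sigma>, w)) has_derivative (\<lambda>v. dc (\<sigma>, w) (0, v))) (at w)" if "\<sigma> \<in> {0..1}" for \<sigma> w
  proof -
    have "((\<lambda>w. (\<sigma>, w)) has_derivative (\<lambda>v. (0, v))) (at w)"
      by (auto intro!: derivative_eq_intros)
    from has_derivative_in_compose2[OF c_deriv _ _ this] that
    show ?thesis by (simp add: image_subset_iff mem_Times_iff)
  qed
  have D: "blinfun_apply (D w \<sigma>) = (\<lambda>v. dc (\<sigma>, w) (0, v))" if "\<sigma> \<in> {0..1}" for \<sigma> w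
    unfolding D_def by (rule bounded_linear_Blinfun_apply[OF has_derivative_bounded_linear[OF c_u[OF that]]])
  have D_cont: "continuous_on (UNIV \<times> {0..s}) (\<lambda>(w, \<sigma>). D w \<sigma>)"
  proof (rule continuous_on_blinfun_componentwise)
    fix v :: "real^'n"
    have "Ck_on 0 ({0..1} \<times> UNIV) (\<lambda>x. dc x (0, v))" using dc_smooth by (simp only: smooth_on_def)
    then have "continuous_on ({0..1} \<times> UNIV) (\<lambda>x. dc x (0, v))" by simp
    then have "continuous_on (UNIV \<times> {0..s}) (\<lambda>x. dc (snd x, fst x) (0, v))"
      by (rule continuous_on_compose2) (use assms(2) in \<open>auto intro!: continuous_intros\<close>)
    then show "continuous_on (UNIV \<times> {0..s}) (\<lambda>x. blinfun_apply (case x of (w, \<sigma>) \<Rightarrow> D w \<sigma>) v)"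
      by (rule continuous_on_eq) (use assms(2) in \<open>auto simp: D\<close>)
  qed
  have D_int: "(D u) integrable_on {0..s}"
    by (intro integrable_continuous_real continuous_on_compose2[OF D_cont, of _ "\<lambda>\<sigma>. (u, \<sigma>)", simplified])
      (auto intro!: continuous_intros)
  have "((\<lambda>w. integral (cbox 0 s) (\<lambda>\<sigma>. c (\<sigma>, w))) has_derivative integral (cbox 0 s) (D u)) (at u within UNIV)"
  proof (rule leibniz_rule)
    show "((\<lambda>w. c (\<sigma>, w)) has_derivative blinfun_apply (D w \<sigma>)) (at w within UNIV)"
      if "\<sigma> \<in> cbox 0 s" for w \<sigma>
      using that assms(2) c_u[of \<sigma>] by (simp add: D)
    show "(\<lambda>\<sigma>. c (\<sigma>, w)) integrable_on cbox 0 s" for w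
      using assms(2) by (auto intro!: integrable_continuous_real continuous_on_subset[OF c_continuous])
    show "continuous_on (UNIV \<times> cbox 0 s) (\<lambda>(w, \<sigma>). D w \<sigma>)" using D_cont by simp
  qed auto
  moreover have "integral {0..s} (D u) v = \<Psi>\<^sub>u s u v" for v
  proof -
    have "integral {0..s} (D u) v = integral {0..s} (\<lambda>\<sigma>. D u \<sigma> v)"
      by (rule blinfun_apply_integral[OF D_int])
    also have "\<dots> = integral {0..s} (\<lambda>\<sigma>. dc (\<sigma>, u) (0, v))"
      using assms(2) by (intro Henstock_Kurzweil_Integration.integral_cong) (simp add: D)
    also have "\<dots> = \<Psi>\<^sub>u s u v"
    proof (cases "v = 0")
      case True
      have "dc (\<sigma>, u) (0, 0) = 0" if "\<sigma> \<in> {0..1}" for \<sigma>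
        using linear_0[OF bounded_linear.linear[OF dc_linear[OF that]], of u] by (simp add: zero_prod_def)
      then have "integral {0..s} (\<lambda>\<sigma>. dc (\<sigma>, u) (0, 0)) = integral {0..s} (\<lambda>\<sigma>. 0)"
        using assms(2) by (intro Henstock_Kurzweil_Integration.integral_cong) simp
      with True show ?thesis by (simp add: \<Psi>\<^sub>u_def)
    next
      case False
      have "((\<lambda>\<sigma>. dc (\<sigma>, u) (0, v)) has_integral M s u v - M 0 u v) {0..s}"
        using assms(2)
        by (intro fundamental_theorem_of_calculus has_vector_derivative_within_subset[OF M_s_deriv[OF assms(1) _ False]]) auto
      with False show ?thesis by (simp add: \<Psi>\<^sub>u_def integral_unique)
    qed
    finally show ?thesis .
  qed
  then have "blinfun_apply (integral {0..s} (D u)) = \<Psi>\<^sub>u s u" by blast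
  ultimately show ?thesis by (simp add: \<Psi>_def[abs_def])
qed

lemma \<Psi>\<^sub>u_smooth: "smooth_on ({0..1} \<times> UNIV) (\<lambda>(s, u). \<Psi>\<^sub>u s u p)"
proof (cases "p = 0")
  case True
  then show ?thesis by (simp add: \<Psi>\<^sub>u_def smooth_on_def Ck_on_const case_prod_unfold)
next
  case False
  show ?thesis unfolding smooth_on_def
  proof
    fix k
    have M: "Ck_on k ({0..1} \<times> UNIV) (\<lambda>(s, u). M s u p)"
      using M_smooth[OF False] by (simp add: smooth_on_def)
    have "Ck_on k ({0..1} \<times> UNIV) (\<lambda>x::real \<times> (real^'n). (0::real, snd x))"
      by (intro Ck_on_Pair Ck_on_const Ck_on_linear bounded_linear_snd)
    from Ck_on_compose[OF _ M this] have "Ck_on k ({0..1} \<times> UNIV) (\<lambda>(s::real, u). M 0 u p)"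
      by (simp add: image_subset_iff case_prod_unfold)
    then have "Ck_on k ({0..1} \<times> UNIV) (\<lambda>x. - (case x of (s::real, u) \<Rightarrow> M 0 u p))"
      by (rule Ck_on_compose_linear[OF bounded_linear_minus[OF bounded_linear_ident]])
    from Ck_on_add[OF M this] False show "Ck_on k ({0..1} \<times> UNIV) (\<lambda>(s, u). \<Psi>\<^sub>u s u p)"
      by (simp add: \<Psi>\<^sub>u_def case_prod_unfold)
  qed
qed

text \<open>The two partial derivatives combine into a total one because the one in u is continuous
  in (s, u) jointly, up to the ends of [0,1].\<close>

lemma \<Psi>_deriv:
  assumes "CARD('n) > 1" "s \<in> {0..1}"
  shows "((\<lambda>(s, u). \<Psi> s u) has_derivative (\<lambda>(\<sigma>, v). \<sigma> * c (s, u) + \<Psi>\<^sub>u s u v)) (at (s, u) within {0..1} \<times> UNIV)"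
proof -
  have D: "blinfun_apply (Blinfun (\<Psi>\<^sub>u \<sigma> w)) = \<Psi>\<^sub>u \<sigma> w" if "\<sigma> \<in> {0..1}" for \<sigma> w
    by (rule bounded_linear_Blinfun_apply[OF has_derivative_bounded_linear[OF \<Psi>_u_deriv[OF assms(1) that]]])
  have "continuous_on ({0..1} \<times> UNIV) (\<lambda>(\<sigma>, w). Blinfun (\<Psi>\<^sub>u \<sigma> w))"
  proof (rule continuous_on_blinfun_componentwise)
    fix v :: "real^'n"
    have "Ck_on 0 ({0..1} \<times> UNIV) (\<lambda>(s, u). \<Psi>\<^sub>u s u v)" using \<Psi>\<^sub>u_smooth by (simp only: smooth_on_def)
    then have "continuous_on ({0..1} \<times> UNIV) (\<lambda>(s, u). \<Psi>\<^sub>u s u v)" by simp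
    then show "continuous_on ({0..1} \<times> UNIV) (\<lambda>x. blinfun_apply (case x of (\<sigma>, w) \<Rightarrow> Blinfun (\<Psi>\<^sub>u \<sigma> w)) v)"
      by (rule continuous_on_eq) (auto simp: D)
  qed
  then have cont: "continuous (at (s, u) within {0..1} \<times> UNIV) (\<lambda>(\<sigma>, w). Blinfun (\<Psi>\<^sub>u \<sigma> w))"
    using assms(2) by (simp add: continuous_on_eq_continuous_within)
  have "((\<lambda>(s, u). \<Psi> s u) has_derivative (\<lambda>(\<sigma>, v). \<sigma> *\<^sub>R c (s, u) + Blinfun (\<Psi>\<^sub>u s u) v))
      (at (s, u) within {0..1} \<times> UNIV)"
    by (rule has_derivative_partialsI[OF \<Psi>_s_deriv[OF assms(2), unfolded has_vector_derivative_def] _ cont])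
      (auto simp: D intro!: \<Psi>_u_deriv assms(1))
  then show ?thesis by (simp add: D[OF assms(2)])
qed

text \<open>The directional derivatives are built from c and \<open>\<Psi>\<^sub>u\<close>, already
  known to be smooth, so order Suc k follows at once without induction.\<close>

lemma \<Psi>_smooth:
  assumes "CARD('n) > 1"
  shows "smooth_on ({0..1} \<times> UNIV) (\<lambda>(s, u). \<Psi> s u)"
proof -
  have "Ck_on (Suc k) ({0..1} \<times> UNIV) (\<lambda>(s, u). \<Psi> s u)" for k
  proof (rule Ck_on_SucI)
    show "((\<lambda>(s, u). \<Psi> s u) has_derivative (\<lambda>v. fst v * c x + \<Psi>\<^sub>u (fst x) (snd x) (snd v))) (at x within {0..1} \<times> UNIV)"
      if "x \<in> {0..1} \<times> UNIV" for x
      using \<Psi>_deriv[OF assms, of "fst x" "snd x"] that by (auto simp: case_prod_unfold)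
    show "Ck_on k ({0..1} \<times> UNIV) (\<lambda>x. fst v * c x + \<Psi>\<^sub>u (fst x) (snd x) (snd v))" for v
      using c_smooth \<Psi>\<^sub>u_smooth[of "snd v"]
      by (intro Ck_on_add Ck_on_compose_linear[OF bounded_linear_mult_right])
        (simp_all add: smooth_on_def case_prod_unfold)
  qed
  then show ?thesis unfolding smooth_on_def by (blast intro: Ck_on_SucD)
qed

text \<open>The first two terms add up to L - M(0, u, p), and M at s = 0 is L - K = p . L_p
  there.\<close>

lemma L_decomposition:
  assumes "CARD('n) > 1" "s \<in> {0..1}" "p \<noteq> 0"
  shows "L s u p = c (s, u) + \<Psi>\<^sub>u s u p + dL (0, u, p) (0, 0, p)"
proof -
  have "c (0, u) = K (0, u, p)"
    using K_independent[OF assms(1) _ assms(3), of 0 1 u] by (simp add: c_def)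
  then show ?thesis using assms(3) by (simp add: \<Psi>\<^sub>u_def M_def K_def)
qed

end

section \<open>Spherical angles and the local representation\<close>

lemma Ck_on_spherical:
  fixes S :: "(real^'m::{finite,linorder}) set"
  shows "Ck_on k S (spherical :: _ \<Rightarrow> real^'n::{finite,linorder})"
proof -
  have sin: "Ck_on k S (\<lambda>\<theta>. sin (\<theta> $ j))" and cos: "Ck_on k S (\<lambda>\<theta>. cos (\<theta> $ j))" for j
    using Ck_on_compose[OF subset_UNIV Ck_on_sin[of k UNIV 0] Ck_on_linear[OF bounded_linear_vec_nth]]
      Ck_on_compose[OF subset_UNIV Ck_on_cos[of k UNIV] Ck_on_linear[OF bounded_linear_vec_nth]] by simp_all
  have "Ck_on k S (\<lambda>\<theta>. (spherical \<theta> :: real^'n::{finite,linorder}) $ i)" for i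
  proof (cases "pos i < CARD('n)")
    case True
    then show ?thesis
      by (simp add: spherical_def) (intro Ck_on_bilinear[OF bounded_bilinear_mult] Ck_on_prod sin cos)
  next
    case False
    then show ?thesis by (simp add: spherical_def) (intro Ck_on_prod sin)
  qed
  then have "Ck_on k S (\<lambda>\<theta>. \<Sum>i\<in>UNIV. (spherical \<theta> :: real^'n::{finite,linorder}) $ i *\<^sub>R (axis i 1 :: real^'n::{finite,linorder}))"
    by (intro Ck_on_sum Ck_on_scaleR_vec)
  then show ?thesis by (simp add: basis_expansion flip: scalar_mult_eq_scaleR)
qed

theorem theorem3p1:
  fixes L :: "real \<Rightarrow> real^'n::{finite,linorder} \<Rightarrow> real^'n::{finite,linorder} \<Rightarrow> real"
    and s\<^sub>0 :: real and u\<^sub>0 p\<^sub>0 :: "real^'n::{finite,linorder}"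
    and \<theta>\<^sub>0 :: "real^'m::{finite,linorder}"
  assumes "CARD('n) > 1"
    and "CARD('n) = CARD('m) + 1"
    and "smooth_lagrangian L"
    and "T_lagrangian L"
    and "s\<^sub>0 \<in> {0..1}"
    and "p\<^sub>0 \<noteq> 0"
    and "p\<^sub>0 = norm p\<^sub>0 *\<^sub>R spherical \<theta>\<^sub>0"
  shows "\<exists>\<Psi> E.
    (\<exists>W. open W \<and> (s\<^sub>0, u\<^sub>0) \<in> W \<and> smooth_on (W \<inter> {0..1} \<times> UNIV) (\<lambda>(s, u). \<Psi> s u)) \<and>
    (\<exists>V. open V \<and> (u\<^sub>0, \<theta>\<^sub>0) \<in> V \<and> smooth_on V (\<lambda>(u, \<theta>). E u \<theta>)) \<and>
    (\<forall>\<^sub>F (s, u, r, \<theta>) in nhds (s\<^sub>0, u\<^sub>0, norm p\<^sub>0, \<theta>\<^sub>0). s \<in> {0..1} \<longrightarrow>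
      (let p = r *\<^sub>R spherical \<theta> in
        L s u p = vderiv01 (\<lambda>\<sigma>. \<Psi> \<sigma> u) s + p \<bullet> grad (\<lambda>w. \<Psi> s w) u + p \<bullet> E u \<theta> \<and>
        (\<forall>j. (\<Sum>i\<in>UNIV. p $ i * grad (\<lambda>\<tau>. E u \<tau> $ i) \<theta> $ j) = 0)))"
proof -
  interpret tangential_lagrangian L using assms by unfold_locales
  \<comment> \<open>The momentum L_p at s = 0 in the direction with angles \<theta>, assembled from
    its coordinates.\<close>
  define E :: "real^'n::{finite,linorder} \<Rightarrow> real^'m::{finite,linorder} \<Rightarrow> real^'n::{finite,linorder}" where
    "E u \<theta> = (\<Sum>i\<in>UNIV. dL (0, u, spherical \<theta>) (0, 0, axis i 1) *\<^sub>R axis i 1)" for u \<theta>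
  \<comment> \<open>An open set of angles around \<open>\<theta>\<^sub>0\<close> on which the
    direction is nonzero, so that L_p is evaluated inside the phase space.\<close>
  define \<Theta> :: "(real^'m::{finite,linorder}) set" where "\<Theta> = {\<theta>. (spherical \<theta> :: real^'n::{finite,linorder}) \<noteq> 0}"
  have sph_cont: "continuous_on UNIV (spherical :: real^'m::{finite,linorder} \<Rightarrow> real^'n::{finite,linorder})"
    using Ck_on_spherical[of 0] by simp
  have \<Theta>_open: "open \<Theta>"
    using open_Collect_neq[OF sph_cont continuous_on_const] by (simp add: \<Theta>_def)
  have \<theta>\<^sub>0: "\<theta>\<^sub>0 \<in> \<Theta>" using assms(6,7) by (auto simp: \<Theta>_def)
  have E_nth: "E u \<theta> $ i = dL (0, u, spherical \<theta>) (0, 0, axis i 1)" for u \<theta> i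
    using basis_expansion[of "\<chi> i. dL (0, u, spherical \<theta>) (0, 0, axis i 1)"]
    by (auto simp: E_def vec_eq_iff simp flip: scalar_mult_eq_scaleR)
  have E_inner: "(\<Sum>i\<in>UNIV. p $ i * E u \<theta> $ i) = dL (0, u, spherical \<theta>) (0, 0, p)"
    if "\<theta> \<in> \<Theta>" for p u \<theta>
  proof -
    interpret B: bounded_linear "\<lambda>v. dL (0, u, spherical \<theta>) (0, 0, v)"
      using that by (intro has_derivative_bounded_linear[OF L_p_deriv]) (auto simp: \<Theta>_def)
    have "dL (0, u, spherical \<theta>) (0, 0, p)
        = dL (0, u, spherical \<theta>) (0, 0, \<Sum>i\<in>UNIV. (p $ i) *\<^sub>R axis i 1)"
      by (simp only: basis_expansion flip: scalar_mult_eq_scaleR)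
    then show ?thesis by (simp only: B.sum B.scaleR real_scaleR_def E_nth)
  qed
  have E_smooth: "smooth_on (UNIV \<times> \<Theta>) (\<lambda>(u, \<theta>). E u \<theta>)"
    unfolding smooth_on_def
  proof
    fix k
    have emb: "Ck_on k (UNIV \<times> \<Theta>) (\<lambda>x. (0::real, fst x :: real^'n::{finite,linorder}, spherical (snd x :: real^'m::{finite,linorder}) :: real^'n::{finite,linorder}))"
      by (intro Ck_on_Pair Ck_on_const Ck_on_linear bounded_linear_fst
          Ck_on_compose[OF subset_UNIV Ck_on_spherical] bounded_linear_snd)
    have "Ck_on k phase_space (\<lambda>x. dL x v)" for v using dL_smooth by (simp add: smooth_on_def)
    from Ck_on_compose[OF _ this emb]
    have "Ck_on k (UNIV \<times> \<Theta>) (\<lambda>x. dL (0, fst x, spherical (snd x)) v)" for v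
      by (simp add: image_subset_iff \<Theta>_def)
    then show "Ck_on k (UNIV \<times> \<Theta>) (\<lambda>(u, \<theta>). E u \<theta>)"
      unfolding E_def case_prod_unfold by (intro Ck_on_sum Ck_on_scaleR_vec)
  qed
  have E_\<theta>: "(\<Sum>i\<in>UNIV. (spherical \<theta> :: real^'n::{finite,linorder}) $ i * grad (\<lambda>\<tau>. E u \<tau> $ i) \<theta> $ j) = 0"
    if "\<theta> \<in> \<Theta>" for u \<theta> j
  proof -
    have "((\<lambda>\<tau>. E u \<tau>) has_derivative (\<lambda>v. deriv_on (UNIV \<times> \<Theta>) (\<lambda>(u, \<theta>). E u \<theta>) (u, \<theta>) (0, v))) (at \<theta> within \<Theta>)"
    proof -
      have "((\<lambda>\<tau>. (u, \<tau>)) has_derivative (\<lambda>v. (0, v))) (at \<theta> within \<Theta>)"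
        by (auto intro!: derivative_eq_intros)
      from has_derivative_in_compose2[OF smooth_on_has_derivative[OF E_smooth] _ _ this] that
      show ?thesis by (simp add: image_subset_iff)
    qed
    moreover have "at \<theta> within \<Theta> = at \<theta>" by (rule at_within_open[OF that \<Theta>_open])
    ultimately obtain E' where "(E u has_derivative E') (at \<theta>)" by auto
    then have E'_nth: "((\<lambda>\<tau>. E u \<tau> $ i) has_derivative (\<lambda>v. E' v $ i)) (at \<theta>)" for i
      by (rule bounded_linear.has_derivative[OF bounded_linear_vec_nth])
    define q :: "real^'n::{finite,linorder}" where "q = spherical \<theta>"
    have q: "q \<noteq> 0" using that by (simp add: q_def \<Theta>_def)
    \<comment> \<open>The weights q are frozen at the base angle \<theta>, so only E is
      differentiated. The same function is the momentum in the fixed direction q, composed with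
      \<open>spherical\<close>, and the Hessian at q annihilates q.\<close>
    have "((\<lambda>\<tau>. \<Sum>i\<in>UNIV. q $ i * E u \<tau> $ i) has_derivative (\<lambda>v. \<Sum>i\<in>UNIV. q $ i * E' v $ i)) (at \<theta>)"
      by (intro has_derivative_sum has_derivative_mult_right E'_nth)
    moreover have "((\<lambda>\<tau>. \<Sum>i\<in>UNIV. q $ i * E u \<tau> $ i) has_derivative (\<lambda>v. 0)) (at \<theta>)"
    proof -
      have "(spherical :: _ \<Rightarrow> real^'n::{finite,linorder}) differentiable (at \<theta>)"
        using Ck_on_spherical[of "Suc 0" UNIV] by (auto simp: differentiable_def)
      then obtain S' where "((spherical :: _ \<Rightarrow> real^'n::{finite,linorder}) has_derivative S') (at \<theta>)"
        by (auto simp: differentiable_def)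
      from has_derivative_compose[OF this hessian_annihilates[of 0 "spherical \<theta>" u]] q
      have "((\<lambda>\<tau>. dL (0, u, spherical \<tau>) (0, 0, q)) has_derivative (\<lambda>v. 0)) (at \<theta>)"
        by (simp add: q_def)
      then show ?thesis
        by (rule has_derivative_transform_within_open[OF _ \<Theta>_open that]) (simp add: E_inner)
    qed
    ultimately have "(\<lambda>v. \<Sum>i\<in>UNIV. q $ i * E' v $ i) = (\<lambda>v. 0)"
      by (rule has_derivative_unique)
    from fun_cong[OF this] have "(\<Sum>i\<in>UNIV. q $ i * E' (axis j 1) $ i) = 0" .
    moreover have "grad (\<lambda>\<tau>. E u \<tau> $ i) \<theta> $ j = E' (axis j 1) $ i" for i
      using grad_inner[OF E'_nth, of i "axis j 1"] by (simp add: inner_axis)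
    ultimately show ?thesis by (simp add: q_def)
  qed
  have rep: "L s u p = vderiv01 (\<lambda>\<sigma>. \<Psi> \<sigma> u) s + p \<bullet> grad (\<lambda>w. \<Psi> s w) u + p \<bullet> E u \<theta> \<and>
        (\<forall>j. (\<Sum>i\<in>UNIV. p $ i * grad (\<lambda>\<tau>. E u \<tau> $ i) \<theta> $ j) = 0)"
    if "s \<in> {0..1}" "r > 0" "\<theta> \<in> \<Theta>" "p = r *\<^sub>R spherical \<theta>" for s u r \<theta> p
  proof
    define q :: "real^'n::{finite,linorder}" where "q = spherical \<theta>"
    have q: "q \<noteq> 0" and p: "p = r *\<^sub>R q" and "p \<noteq> 0" using that by (auto simp: q_def \<Theta>_def)
    interpret dLp: bounded_linear "dL (0, u, p)" using \<open>p \<noteq> 0\<close> by (intro dL_linear) simp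
    interpret dLq: bounded_linear "dL (0, u, q)" using q by (intro dL_linear) simp
    \<comment> \<open>The base point moves from p = r q to q: linearity extracts r from the
      direction, homogeneity of degree zero replaces the base point, and linearity puts r
      back.\<close>
    have "dL (0, u, p) (0, 0, p) = r * dL (0, u, p) (0, 0, q)"
      using dLp.scaleR[of r "(0, 0, q)"] p by simp
    also have "\<dots> = r * dL (0, u, q) (0, 0, q)"
      using momentum_homogeneous[of 0 q r u] q that(2) p by simp
    also have "\<dots> = dL (0, u, q) (0, 0, p)"
      using dLq.scaleR[of r "(0, 0, q)"] p by simp
    also have "\<dots> = p \<bullet> E u \<theta>"
      using E_inner[OF that(3), of p u] by (simp add: q_def inner_vec_def)
    finally have "dL (0, u, p) (0, 0, p) = p \<bullet> E u \<theta>" .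
    moreover have "vderiv01 (\<lambda>\<sigma>. \<Psi> \<sigma> u) s = c (s, u)"
      by (rule vderiv01_eq[OF that(1) \<Psi>_s_deriv[OF that(1)]])
    moreover have "p \<bullet> grad (\<lambda>w. \<Psi> s w) u = \<Psi>\<^sub>u s u p"
      using grad_inner[OF \<Psi>_u_deriv[OF assms(1) that(1)], of u p] by (simp add: inner_commute)
    ultimately show "L s u p = vderiv01 (\<lambda>\<sigma>. \<Psi> \<sigma> u) s + p \<bullet> grad (\<lambda>w. \<Psi> s w) u + p \<bullet> E u \<theta>"
      using L_decomposition[OF assms(1) that(1) \<open>p \<noteq> 0\<close>] by simp
    show "\<forall>j. (\<Sum>i\<in>UNIV. p $ i * grad (\<lambda>\<tau>. E u \<tau> $ i) \<theta> $ j) = 0"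
      using E_\<theta>[OF that(3), of u] that(4) by (simp add: mult.assoc flip: sum_distrib_left)
  qed
  \<comment> \<open>The identities hold for all u and all s in [0,1]; the neighbourhood only has to
    secure r > 0 and \<theta> in \<Theta>, both open conditions valid at the base point.\<close>
  have "open (UNIV \<times> UNIV \<times> {0<..} \<times> \<Theta> :: (real \<times> (real^'n::{finite,linorder}) \<times> real \<times> (real^'m::{finite,linorder})) set)"
    by (intro open_Times open_UNIV open_greaterThan \<Theta>_open)
  then have "\<forall>\<^sub>F x in nhds (s\<^sub>0, u\<^sub>0, norm p\<^sub>0, \<theta>\<^sub>0). x \<in> UNIV \<times> UNIV \<times> {0<..} \<times> \<Theta>"
    by (rule eventually_nhds_in_open) (use \<theta>\<^sub>0 assms(6) in simp)
  then have ev: "\<forall>\<^sub>F (s, u, r, \<theta>) in nhds (s\<^sub>0, u\<^sub>0, norm p\<^sub>0, \<theta>\<^sub>0). s \<in> {0..1} \<longrightarrow>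
      (let p = r *\<^sub>R spherical \<theta> in
        L s u p = vderiv01 (\<lambda>\<sigma>. \<Psi> \<sigma> u) s + p \<bullet> grad (\<lambda>w. \<Psi> s w) u + p \<bullet> E u \<theta> \<and>
        (\<forall>j. (\<Sum>i\<in>UNIV. p $ i * grad (\<lambda>\<tau>. E u \<tau> $ i) \<theta> $ j) = 0))"
    by (rule eventually_mono) (clarsimp simp only: Let_def mem_Times_iff, rule rep[OF _ _ _ refl], simp_all)
  show ?thesis
  proof (rule exI[of _ \<Psi>], rule exI[of _ E], intro conjI ev)
    show "\<exists>W. open W \<and> (s\<^sub>0, u\<^sub>0) \<in> W \<and> smooth_on (W \<inter> {0..1} \<times> UNIV) (\<lambda>(s, u). \<Psi> s u)"
      by (rule exI[of _ UNIV]) (simp add: \<Psi>_smooth[OF assms(1)])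
    show "\<exists>V. open V \<and> (u\<^sub>0, \<theta>\<^sub>0) \<in> V \<and> smooth_on V (\<lambda>(u, \<theta>). E u \<theta>)"
      by (rule exI[of _ "UNIV \<times> \<Theta>"]) (simp add: E_smooth \<theta>\<^sub>0 open_Times \<Theta>_open)
  qed
qed

end
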